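(* Let $d\ge 2$ and let $D$ be a balanced $d$-ary tree with at least two leaves, with branches $D_1,D_2,\ldots,D_d$ (some of which may be empty). Then $$I_d(D)\le\frac{|M(D)|}{d^{\|D\|}-d}\binom{\|D\|}{\|D_1\|,\|D_2\|,\ldots,\|D_d\|}\prod_{i=1}^d I_d(D_i).$$ Furthermore, if $I_d(D_i)=\eta_d(D_i)$ for all $i$, then also $I_d(D)=\eta_d(D)$.
   Context: A $d$-ary tree is a finite rooted tree in which every internal (non-leaf) vertex has at least two and at most $d$ children; a single vertex is a $d$-ary tree with one leaf, and the empty tree with $0$ leaves is also allowed. Isomorphism means root-preserving isomorphism (two empty trees are isomorphic). $\|T\|$ denotes the number of leaves of $T$. A set $S$ of leaves of $T$ induces a $d$-ary tree: take the smallest subtree of $T$ containing all leaves in $S$ (rooted at the most recent common ancestor of $S$) and repeatedly suppress every vertex with exactly one child (contracting its two adjacent edges to a single edge). $c(D,T)$ is the number of sets of $\|D\|$ leaves of $T$ that induce a tree isomorphic to $D$ (with $c(D,T)=1$ if $D$ is empty), and $\gamma(D,T)=c(D,T)/\binom{\|T\|}{\|D\|}$. The $d$-ary inducibility of a nonempty $d$-ary tree $D$ is $$I_d(D)=\limsup_{n\to\infty}\ \max_{\substack{\|T\|=n\\ T\ d\text{-ary tree}}}\gamma(D,T),$$ and $I_d(D)=1$ if $D$ is empty. The branches of a $d$-ary tree $D$ with at least two leaves are the components (rooted at the children of the root) obtained on removing the root; the list is padded with empty trees to have exactly $d$ entries $D_1,\ldots,D_d$. On the set of permutations of $[d]=\{1,\ldots,d\}$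 define $\pi\sim_D\pi'$ if $D_{\pi(j)}$ is isomorphic to $D_{\pi'(j)}$ for every $j\in[d]$; $M(D)$ is a complete set of representatives of the equivalence classes of $\sim_D$. A $d$-ary tree $D$ is balanced if its branches $D_1,\ldots,D_d$ (including the empty ones) satisfy $\big|\|D_i\|-\|D_j\|\big|\le 1$ for all $i,j$. The strictly $d$-ary trees $H_n^d$ ($n\ge 0$) are defined recursively: $H_0^d$ is a single leaf; for $n>0$ write $n-1=ds+b$ with $b\in\{0,1,\ldots,d-1\}$, take $d-b$ copies of $H_s^d$ and $b$ copies of $H_{s+1}^d$, and connect a new common root to each of their roots by an edge to obtain $H_n^d$, which has $(d-1)n+1$ leaves. For a $d$-ary tree $D$, $\eta_d(D)=\lim_{n\to\infty}\gamma(D,H_n^d)$ (this limit exists; it equals $1$ if $D$ is empty). *)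

theory Defs
  imports Complex_Main "HOL-Library.Extended_Real" "HOL-Combinatorics.Permutations"
begin

text \<open>
  Nonempty rooted trees. The children are listed in some order so that vertices have names
  (the path of child indices leading to them); nothing below depends on that order, and trees are
  compared only up to \<open>isomorphic\<close>. A single leaf is \<open>Node []\<close>.

  Possibly empty trees are elements of \<open>rtree option\<close>, with \<open>None\<close> the empty tree.
\<close>

datatype rtree = Node "rtree list"

lemma size_nth_less [termination_simp]: "i < length ts \<Longrightarrow> size (ts ! i) < Suc (size_list size ts)"
  by (auto simp: less_Suc_eq_le intro: size_list_estimation'[OF nth_mem])

fun vertices :: "rtree \<Rightarrow> nat list set" where
  "vertices (Node ts) = insert [] (\<Union>i<length ts. (#) i ` vertices (ts ! i))"

definition leaves :: "rtree \<Rightarrow> nat list set" where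
  "leaves t = {v \<in> vertices t. \<forall>i. v @ [i] \<notin> vertices t}"

definition adjacent :: "nat list \<Rightarrow> nat list \<Rightarrow> bool" where
  "adjacent u v \<longleftrightarrow> (\<exists>i. v = u @ [i] \<or> u = v @ [i])"

definition isomorphic :: "rtree \<Rightarrow> rtree \<Rightarrow> bool" where
  "isomorphic t t' \<longleftrightarrow> (\<exists>f. bij_betw f (vertices t) (vertices t') \<and> f [] = [] \<and>
     (\<forall>u\<in>vertices t. \<forall>v\<in>vertices t. adjacent (f u) (f v) \<longleftrightarrow> adjacent u v))"

fun dary_nonempty :: "nat \<Rightarrow> rtree \<Rightarrow> bool" where
  "dary_nonempty d (Node ts) \<longleftrightarrow>
     (ts = [] \<or> 2 \<le> length ts \<and> length ts \<le> d) \<and> (\<forall>t\<in>set ts. dary_nonempty d t)"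

fun dary :: "nat \<Rightarrow> rtree option \<Rightarrow> bool" where
  "dary d None = True"
| "dary d (Some t) = dary_nonempty d t"

fun leaf_set :: "rtree option \<Rightarrow> nat list set" where
  "leaf_set None = {}"
| "leaf_set (Some t) = leaves t"

definition num_leaves :: "rtree option \<Rightarrow> nat" where
  "num_leaves T = card (leaf_set T)"

text \<open>
  For nonempty \<open>S\<close>, \<open>prune t S\<close> is the smallest subtree containing the root of \<open>t\<close> and all leaves
  in \<open>S\<close>. Suppressing the vertices with exactly one child also removes the path from the root of
  \<open>t\<close> down to the most recent common ancestor of \<open>S\<close>, which becomes the new root.
\<close>

fun prune :: "rtree \<Rightarrow> nat list set \<Rightarrow> rtree" where
  "prune (Node ts) S =
     Node (map (\<lambda>i. prune (ts ! i) {p. i # p \<in> S})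
            (filter (\<lambda>i. {p. i # p \<in> S} \<noteq> {}) [0..<length ts]))"

fun suppress :: "rtree \<Rightarrow> rtree" where
  "suppress (Node [t]) = suppress t"
| "suppress (Node ts) = Node (map suppress ts)"

fun induced :: "rtree option \<Rightarrow> nat list set \<Rightarrow> rtree option" where
  "induced None S = None"
| "induced (Some t) S = (if S = {} then None else Some (suppress (prune t S)))"

text \<open>If \<open>D\<close> is empty, then exactly \<open>S = {}\<close> is counted, so \<open>copies None T = 1\<close>.\<close>

definition copies :: "rtree option \<Rightarrow> rtree option \<Rightarrow> nat" where
  "copies D T = card {S. S \<subseteq> leaf_set T \<and> card S = num_leaves D \<and>
                        rel_option isomorphic (induced T S) D}"

definition density :: "rtree option \<Rightarrow> rtree option \<Rightarrow> real" where
  "density D T = real (copies D T) / real (num_leaves T choose num_leaves D)"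

definition max_density :: "nat \<Rightarrow> rtree option \<Rightarrow> nat \<Rightarrow> real" where
  "max_density d D n = Max {density D T | T. dary d T \<and> num_leaves T = n}"

text \<open>
  The limsup is taken in the extended reals because \<open>Limsup\<close> needs a complete lattice; all
  densities lie in \<open>{0..1}\<close>, so the conversion back to \<open>real\<close> loses nothing.
\<close>

definition inducibility :: "nat \<Rightarrow> rtree option \<Rightarrow> real" where
  "inducibility d D =
     (if D = None then 1 else real_of_ereal (limsup (\<lambda>n. ereal (max_density d D n))))"

text \<open>The branches of a tree, padded with empty trees and indexed by \<open>{..<d}\<close>.\<close>

fun branch :: "nat \<Rightarrow> rtree \<Rightarrow> nat \<Rightarrow> rtree option" where
  "branch d (Node ts) i = (map Some ts @ replicate (d - length ts) None) ! i"

definition perm_rel :: "nat \<Rightarrow> rtree \<Rightarrow> ((nat \<Rightarrow> nat) \<times> (nat \<Rightarrow> nat)) set" where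
  "perm_rel d D = {(\<pi>, \<pi>'). \<pi> permutes {..<d} \<and> \<pi>' permutes {..<d} \<and>
     (\<forall>j<d. rel_option isomorphic (branch d D (\<pi> j)) (branch d D (\<pi>' j)))}"

text \<open>A complete set of representatives of the classes of \<open>perm_rel d D\<close>.\<close>

definition perm_reps :: "nat \<Rightarrow> rtree \<Rightarrow> (nat \<Rightarrow> nat) set" where
  "perm_reps d D = (\<lambda>C. SOME \<pi>. \<pi> \<in> C) ` ({\<pi>. \<pi> permutes {..<d}} // perm_rel d D)"

definition balanced :: "nat \<Rightarrow> rtree \<Rightarrow> bool" where
  "balanced d D \<longleftrightarrow> (\<forall>i<d. \<forall>j<d.
     \<bar>int (num_leaves (branch d D i)) - int (num_leaves (branch d D j))\<bar> \<le> 1)"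

text \<open>With \<open>m = n - 1 = d s + b\<close>: \<open>d - b\<close> copies of \<open>H\<^sub>s\<close> followed by \<open>b\<close> copies of \<open>H\<^sub>s\<^sub>+\<^sub>1\<close>.\<close>

function H_tree :: "nat \<Rightarrow> nat \<Rightarrow> rtree" where
  "H_tree d 0 = Node []"
| "H_tree d (Suc m) =
     Node (map (\<lambda>j. H_tree d (if j < d - m mod d then m div d else Suc (m div d))) [0..<d])"
  by pat_completeness auto
termination
proof (relation "measure snd", goal_cases)
  case (2 d m j)
  have "m div d < m" if "\<not> j < d - m mod d"
  proof -
    have "0 < m mod d" using that 2 by auto
    moreover from this have "d \<noteq> 1" by (auto intro: Nat.gr0I)
    ultimately show ?thesis using 2 by (intro div_less_dividend) (auto intro: Nat.gr0I)
  qed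
  then show ?case by (auto simp: less_Suc_eq_le)
qed simp

definition eta :: "nat \<Rightarrow> rtree option \<Rightarrow> real" where
  "eta d D = lim (\<lambda>n. density D (Some (H_tree d n)))"

end

theory Submission
  imports Defs
begin

text \<open>
  Let \<open>D\<close> have branches \<open>D\<^sub>i\<close> with \<open>k\<^sub>i\<close> leaves and \<open>k\<close> leaves in total. A leaf set inducing \<open>D\<close> in
  \<open>T\<close> lies in one branch of \<open>T\<close> or distributes the branches of \<open>D\<close> over those of \<open>T\<close>, hence
  \<open>c(D, T) = \<Sum>\<^sub>j c(D, T\<^sub>j) + |M(D)| / d! \<cdot> \<Sum>\<^sub>\<pi> \<Prod>\<^sub>i c(D\<^sub>i, T\<^bsub>\<pi>(i)\<^esub>)\<close>. Bounding \<open>c(D\<^sub>i, T\<^sub>j)\<close> by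
  \<open>I(D\<^sub>i) \<cdot> n\<^sub>j ^ k\<^sub>i / k\<^sub>i!\<close> and using Muirhead's inequality, in which the balanced exponent vector gives the
  smallest symmetric sum among all terms of \<open>(n\<^sub>1 + \<dots> + n\<^sub>d) ^ k\<close>, one obtains \<open>c(D, T) \<le> Q \<cdot> n ^ k\<close> by
  induction on \<open>T\<close>. For \<open>T = H\<^sub>n\<close> all branches have asymptotically the same size, and the recurrence
  is a contraction whose limit is the same expression with \<open>\<eta>(D\<^sub>i)\<close> in place of \<open>I(D\<^sub>i)\<close>.
\<close>

text \<open>The induction on \<open>T\<close> has no room for error terms: a large tree may have
  small branches, and errors would add up over the levels. Each \<open>c(D_i, T_j)\<close> therefore
  needs a bound valid at every size, although \<open>I(D_i)\<close> is only a limsup; blowing up the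
  leaves of \<open>T_j\<close> supplies it. The induction then closes through the expansion of
  \<open>(n_1 + ... + n_d) ^ k\<close>: its \<open>d\<close> pure powers account for the copies
  inside one branch, and its \<open>d ^ k - d\<close> mixed terms pay for the copies that are spread
  out. The same \<open>d ^ k - d\<close> arises for \<open>H_n\<close> from a fixed-point equation.
  A branch of \<open>H_n\<close> has about \<open>1 / d\<close> of the leaves, so the limit
  \<open>a\<close> of \<open>c(D, H_n)\<close>, divided by the \<open>k\<close>-th power of the leaf
  number, satisfies \<open>a = d * (1 / d) ^ k * a + |M(D)| * P / d ^ k\<close>, where
  \<open>P\<close> is the product of the corresponding limits for the \<open>D_i\<close>. Hence
  upper bound and limit coincide as soon as they do for all branches. The factor
  \<open>|M(D)| / d!\<close> corrects an overcount: a spread-out set is matched by as many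
  permutations as there are permutations exchanging only isomorphic branches of
  \<open>D\<close>.\<close>

abbreviation opt_iso :: "rtree option \<Rightarrow> rtree option \<Rightarrow> bool" where
  "opt_iso \<equiv> rel_option isomorphic"

abbreviation below :: "nat \<Rightarrow> nat list set \<Rightarrow> nat list set" where
  "below i S \<equiv> {p. i # p \<in> S}"

subsection \<open>Isomorphism and children\<close>

lemma Nil_in_vertices [simp]: "[] \<in> vertices t"
  by (cases t) auto

lemma Cons_in_vertices [simp]:
  "i # p \<in> vertices (Node ts) \<longleftrightarrow> i < length ts \<and> p \<in> vertices (ts ! i)"
  by auto

declare vertices.simps [simp del]

lemma vertices_appendD: "v @ w \<in> vertices t \<Longrightarrow> v \<in> vertices t"
proof (induction v arbitrary: t)
  case (Cons i v)
  then show ?case by (cases t) (auto)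
qed simp

lemma adjacent_Cons [simp]: "adjacent (i # p) (j # q) \<longleftrightarrow> i = j \<and> adjacent p q"
  by (auto simp: adjacent_def)

lemma adjacent_Nil [simp]: "adjacent [] (i # p) \<longleftrightarrow> p = []" "adjacent (i # p) [] \<longleftrightarrow> p = []"
  "\<not> adjacent [] []"
  by (auto simp: adjacent_def)

lemma isomorphic_refl: "isomorphic t t"
  unfolding isomorphic_def by (rule exI[of _ id]) auto

lemma isomorphic_sym:
  assumes "isomorphic s t" shows "isomorphic t s"
proof -
  obtain f where f: "bij_betw f (vertices s) (vertices t)" "f [] = []"
    "\<And>u v. u \<in> vertices s \<Longrightarrow> v \<in> vertices s \<Longrightarrow> adjacent (f u) (f v) \<longleftrightarrow> adjacent u v"
    using assms unfolding isomorphic_def by blast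
  let ?g = "the_inv_into (vertices s) f"
  have g: "bij_betw ?g (vertices t) (vertices s)" by (rule bij_betw_the_inv_into[OF f(1)])
  have fg: "f (?g v) = v" if "v \<in> vertices t" for v
    using f(1) that by (auto simp: bij_betw_def intro: f_the_inv_into_f)
  have "?g [] = []" using f by (metis Nil_in_vertices bij_betw_def the_inv_into_f_eq)
  moreover have "adjacent (?g u) (?g v) \<longleftrightarrow> adjacent u v"
    if "u \<in> vertices t" "v \<in> vertices t" for u v
    using f(3)[of "?g u" "?g v"] fg that g by (simp add: bij_betwE)
  ultimately show ?thesis unfolding isomorphic_def using g by blast
qed

lemma isomorphic_trans:
  assumes "isomorphic s t" "isomorphic t u" shows "isomorphic s u"
proof -
  obtain f where f: "bij_betw f (vertices s) (vertices t)" "f [] = []"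
    "\<And>u v. u \<in> vertices s \<Longrightarrow> v \<in> vertices s \<Longrightarrow> adjacent (f u) (f v) \<longleftrightarrow> adjacent u v"
    using assms unfolding isomorphic_def by blast
  obtain g where g: "bij_betw g (vertices t) (vertices u)" "g [] = []"
    "\<And>u v. u \<in> vertices t \<Longrightarrow> v \<in> vertices t \<Longrightarrow> adjacent (g u) (g v) \<longleftrightarrow> adjacent u v"
    using assms unfolding isomorphic_def by blast
  show ?thesis unfolding isomorphic_def
    using bij_betw_trans[OF f(1) g(1)] f g by (intro exI[of _ "g \<circ> f"]) (auto simp: bij_betwE)
qed

lemma opt_iso_refl: "opt_iso x x"
  by (cases x) (auto intro: isomorphic_refl)

lemma opt_iso_sym: "opt_iso x y \<Longrightarrow> opt_iso y x"
  by (cases x; cases y) (auto intro: isomorphic_sym)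

lemma opt_iso_trans: "opt_iso x y \<Longrightarrow> opt_iso y z \<Longrightarrow> opt_iso x z"
  by (cases x; cases y; cases z) (auto intro: isomorphic_trans)

text \<open>Adjacency together with the fixed root determines which neighbour is the parent, so an
  undirected isomorphism respects the levels. This recursive form of \<open>isomorphic\<close> is
  what the inductions on trees use.\<close>

lemma isomorphic_Node:
  "isomorphic (Node ts) (Node us) \<longleftrightarrow>
     (\<exists>\<sigma>. bij_betw \<sigma> {..<length ts} {..<length us} \<and> (\<forall>i<length ts. isomorphic (ts ! i) (us ! \<sigma> i)))"
proof
  let ?V = "vertices (Node ts)" and ?W = "vertices (Node us)"
  assume "isomorphic (Node ts) (Node us)"
  then obtain f where bij: "bij_betw f ?V ?W" and f0: "f [] = []"
    and adj: "\<And>u v. u \<in> ?V \<Longrightarrow> v \<in> ?V \<Longrightarrow> adjacent (f u) (f v) \<longleftrightarrow> adjacent u v"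
    unfolding isomorphic_def by blast
  have inj: "u = v" if "f u = f v" "u \<in> ?V" "v \<in> ?V" for u v
    using bij_betw_imp_inj_on[OF bij] that by (rule inj_onD)
  \<comment> \<open>A neighbour of \<open>f v\<close> is its parent or a child. For
    \<open>v = w @ [l]\<close> the parent is \<open>f w\<close> by induction, and injectivity keeps
    \<open>f (v @ [i])\<close> away from it.\<close>
  have child: "\<exists>j. f (v @ [i]) = f v @ [j]" if "v @ [i] \<in> ?V" for v i
    using that
  proof (induction v arbitrary: i rule: rev_induct)
    case Nil
    then have "adjacent (f []) (f [i])" by (subst adj) simp_all
    then show ?case using f0 by (auto simp: adjacent_def)
  next
    case (snoc l w)
    have v: "w @ [l] \<in> ?V" and w: "w \<in> ?V"
      using snoc.prems vertices_appendD by blast+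
    have "adjacent (f (w @ [l])) (f ((w @ [l]) @ [i]))"
      using snoc.prems v by (subst adj) (auto simp: adjacent_def)
    moreover obtain m where m: "f (w @ [l]) = f w @ [m]" using snoc.IH v by blast
    moreover have "f ((w @ [l]) @ [i]) \<noteq> f w" using inj[OF _ snoc.prems w] by auto
    ultimately show ?case by (auto simp: adjacent_def)
  qed
  \<comment> \<open>Since levels are respected, \<open>f\<close> moves the whole subtree of child
    \<open>i\<close> into a single subtree: the first index of the image gives
    \<open>\<sigma> i\<close>, the rest gives \<open>g i\<close>.\<close>
  define \<sigma> where "\<sigma> i = hd (f [i])" for i
  define g where "g i p = tl (f (i # p))" for i p
  have fC: "f (i # p) = \<sigma> i # g i p" if "i # p \<in> ?V" for i p
    using that
  proof (induction p rule: rev_induct)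
    case Nil
    then show ?case using child[of "[]" i] f0 by (auto simp: \<sigma>_def g_def)
  next
    case (snoc l p)
    have "i # p \<in> ?V" using vertices_appendD[of "i # p" "[l]"] snoc.prems
      by (simp del: Cons_in_vertices)
    moreover obtain j where "f (i # p @ [l]) = f (i # p) @ [j]"
      using child[of "i # p" l] snoc.prems by auto
    ultimately have "f (i # p @ [l]) = \<sigma> i # (g i p @ [j])" using snoc.IH by simp
    then show ?case by (simp add: g_def)
  qed
  have fW: "f v \<in> ?W" if "v \<in> ?V" for v using bij that by (simp add: bij_betwE)
  have fsurj: "\<exists>i q. i # q \<in> ?V \<and> j = \<sigma> i \<and> p = g i q" if "j # p \<in> ?W" for j p
  proof -
    have "j # p \<in> f ` ?V" using that by (simp only: bij_betw_imp_surj_on[OF bij])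
    then obtain v where v: "v \<in> ?V" "j # p = f v" by blast
    then obtain i q where "v = i # q" using f0 by (cases v) auto
    then show ?thesis using v fC[of i q] by (intro exI[of _ i] exI[of _ q]) simp
  qed
  have \<sigma>inj: "i = i'" if "\<sigma> i = \<sigma> i'" "i < length ts" "i' < length ts" for i i'
  proof -
    have "g i [] = []" if "i < length ts" for i
      using child[of "[]" i] f0 fC[of i "[]"] that by (auto)
    then have "f [i] = f [i']" using fC[of i "[]"] fC[of i' "[]"] that by simp
    then show ?thesis using inj[of "[i]" "[i']"] that by simp
  qed
  have \<sigma>r: "\<sigma> i < length us" if "i < length ts" for i
    using fW[of "[i]"] fC[of i "[]"] that by (auto)
  have "bij_betw \<sigma> {..<length ts} {..<length us}"
    unfolding bij_betw_def
  proof
    show "inj_on \<sigma> {..<length ts}" by (auto intro!: inj_onI \<sigma>inj)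
    show "\<sigma> ` {..<length ts} = {..<length us}"
    proof (intro equalityI subsetI)
      fix j assume "j \<in> {..<length us}"
      then show "j \<in> \<sigma> ` {..<length ts}" using fsurj[of j "[]"] by (auto)
    qed (auto intro: \<sigma>r)
  qed
  moreover have "isomorphic (ts ! i) (us ! \<sigma> i)" if i: "i < length ts" for i
    unfolding isomorphic_def
  proof (intro exI[of _ "g i"] conjI ballI)
    show "g i [] = []" using child[of "[]" i] f0 fC[of i "[]"] i by (auto)
    show "bij_betw (g i) (vertices (ts ! i)) (vertices (us ! \<sigma> i))"
      unfolding bij_betw_def
    proof
      show "inj_on (g i) (vertices (ts ! i))"
      proof (rule inj_onI)
        fix p q assume "p \<in> vertices (ts ! i)" "q \<in> vertices (ts ! i)" "g i p = g i q"
        then show "p = q" using inj[of "i # p" "i # q"] fC[of i p] fC[of i q] i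
          by simp
      qed
      show "g i ` vertices (ts ! i) = vertices (us ! \<sigma> i)"
      proof (intro equalityI subsetI)
        fix p assume "p \<in> vertices (us ! \<sigma> i)"
        then obtain i' q where q: "i' # q \<in> ?V" "\<sigma> i = \<sigma> i'" "p = g i' q"
          using fsurj[of "\<sigma> i" p] \<sigma>r i by (auto)
        then have "i' = i" using \<sigma>inj[of i i'] i by simp
        then show "p \<in> g i ` vertices (ts ! i)" using q by (auto)
      next
        fix p assume "p \<in> g i ` vertices (ts ! i)"
        then show "p \<in> vertices (us ! \<sigma> i)" using fW[of "i # _"] fC i
          by (auto)
      qed
    qed
    fix p q assume "p \<in> vertices (ts ! i)" "q \<in> vertices (ts ! i)"
    then show "adjacent (g i p) (g i q) \<longleftrightarrow> adjacent p q"
      using adj[of "i # p" "i # q"] fC[of i p] fC[of i q] i by simp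
  qed
  ultimately show "\<exists>\<sigma>. bij_betw \<sigma> {..<length ts} {..<length us} \<and>
      (\<forall>i<length ts. isomorphic (ts ! i) (us ! \<sigma> i))" by blast
next
  assume "\<exists>\<sigma>. bij_betw \<sigma> {..<length ts} {..<length us} \<and>
      (\<forall>i<length ts. isomorphic (ts ! i) (us ! \<sigma> i))"
  then obtain \<sigma> where \<sigma>: "bij_betw \<sigma> {..<length ts} {..<length us}"
    and "\<forall>i<length ts. isomorphic (ts ! i) (us ! \<sigma> i)" by blast
  then obtain f where f: "\<And>i. i < length ts \<Longrightarrow> bij_betw (f i) (vertices (ts ! i)) (vertices (us ! \<sigma> i))"
    and f0: "\<And>i. i < length ts \<Longrightarrow> f i [] = []"
    and adj: "\<And>i u v. i < length ts \<Longrightarrow> u \<in> vertices (ts ! i) \<Longrightarrow> v \<in> vertices (ts ! i) \<Longrightarrow>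
        adjacent (f i u) (f i v) \<longleftrightarrow> adjacent u v"
    unfolding isomorphic_def by metis
  define g where "g v = (case v of [] \<Rightarrow> [] | i # p \<Rightarrow> \<sigma> i # f i p)" for v
  have g [simp]: "g [] = []" "g (i # p) = \<sigma> i # f i p" for i p by (simp_all add: g_def)
  have \<sigma>inj: "\<sigma> i = \<sigma> j \<longleftrightarrow> i = j" if "i < length ts" "j < length ts" for i j
    using inj_on_eq_iff[OF bij_betw_imp_inj_on[OF \<sigma>], of i j] that by simp
  have finj: "f i p = f i q \<longleftrightarrow> p = q"
    if "i < length ts" "p \<in> vertices (ts ! i)" "q \<in> vertices (ts ! i)" for i p q
    using inj_on_eq_iff[OF bij_betw_imp_inj_on[OF f[OF that(1)]] that(2,3)] .
  have fNil: "f i p = [] \<longleftrightarrow> p = []" if "i < length ts" "p \<in> vertices (ts ! i)" for i p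
    using finj[of i p "[]"] f0 that by auto
  show "isomorphic (Node ts) (Node us)"
    unfolding isomorphic_def
  proof (intro exI[of _ g] conjI ballI)
    show "bij_betw g (vertices (Node ts)) (vertices (Node us))"
      unfolding bij_betw_def
    proof
      show "inj_on g (vertices (Node ts))"
      proof (rule inj_onI)
        fix u v assume "u \<in> vertices (Node ts)" "v \<in> vertices (Node ts)" "g u = g v"
        then show "u = v" using \<sigma>inj finj by (cases u; cases v) auto
      qed
      show "g ` vertices (Node ts) = vertices (Node us)"
      proof (intro equalityI subsetI)
        fix v assume "v \<in> g ` vertices (Node ts)"
        then obtain u where "u \<in> vertices (Node ts)" "v = g u" by blast
        then show "v \<in> vertices (Node us)"
          using bij_betwE[OF f] bij_betwE[OF \<sigma>] by (cases u) auto
      next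
        fix v assume v: "v \<in> vertices (Node us)"
        show "v \<in> g ` vertices (Node ts)"
        proof (cases v)
          case Nil
          then show ?thesis by (auto intro: image_eqI[of _ _ "[]"])
        next
          case (Cons j p)
          then have "j \<in> \<sigma> ` {..<length ts}" using v by (simp add: bij_betw_imp_surj_on[OF \<sigma>])
          then obtain i where i: "i < length ts" "j = \<sigma> i" by blast
          moreover have "p \<in> f i ` vertices (ts ! i)"
            using v Cons i by (simp add: bij_betw_imp_surj_on[OF f[OF i(1)]])
          then obtain q where "q \<in> vertices (ts ! i)" "p = f i q" by blast
          ultimately show ?thesis using Cons by (intro image_eqI[of _ _ "i # q"]) auto
        qed
      qed
    qed
    show "g [] = []" by simp
    fix u v assume "u \<in> vertices (Node ts)" "v \<in> vertices (Node ts)"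
    then show "adjacent (g u) (g v) \<longleftrightarrow> adjacent u v"
      using \<sigma>inj adj fNil
      by (cases u; cases v) (auto)
  qed
qed

subsection \<open>Leaves and branches\<close>

lemma Nil_in_leaves [simp]: "[] \<in> leaves (Node ts) \<longleftrightarrow> ts = []"
proof
  assume "[] \<in> leaves (Node ts)"
  then have "[0] \<notin> vertices (Node ts)" unfolding leaves_def by force
  then show "ts = []" by simp
qed (auto simp: leaves_def)

lemma Cons_in_leaves [simp]: "i # p \<in> leaves (Node ts) \<longleftrightarrow> i < length ts \<and> p \<in> leaves (ts ! i)"
  by (auto simp: leaves_def)

lemma leaves_leaf [simp]: "leaves (Node []) = {[]}"
proof -
  have "v \<in> leaves (Node []) \<longleftrightarrow> v = []" for v by (cases v) auto
  then show ?thesis by auto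
qed

lemma leaves_Node: "ts \<noteq> [] \<Longrightarrow> leaves (Node ts) = (\<Union>i<length ts. (#) i ` leaves (ts ! i))"
proof (intro set_eqI)
  fix v assume "ts \<noteq> []"
  then show "v \<in> leaves (Node ts) \<longleftrightarrow> v \<in> (\<Union>i<length ts. (#) i ` leaves (ts ! i))"
    by (cases v) auto
qed

lemma finite_leaves: "finite (leaves t)"
proof (induction t)
  case (Node ts)
  then show ?case by (cases "ts = []") (auto simp: leaves_Node)
qed

lemma finite_leaf_set: "finite (leaf_set T)"
  by (cases T) (auto simp: finite_leaves)

lemma card_leaves_Node:
  assumes "ts \<noteq> []" shows "card (leaves (Node ts)) = (\<Sum>i<length ts. card (leaves (ts ! i)))"
proof -
  have "card (leaves (Node ts)) = (\<Sum>i<length ts. card ((#) i ` leaves (ts ! i)))"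
    unfolding leaves_Node[OF assms] by (rule card_UN_disjoint) (auto simp: finite_leaves)
  also have "\<dots> = (\<Sum>i<length ts. card (leaves (ts ! i)))"
    by (intro sum.cong refl card_image) (auto intro: injI)
  finally show ?thesis .
qed

lemma num_leaves_None [simp]: "num_leaves None = 0"
  by (simp add: num_leaves_def)

lemma num_leaves_leaf [simp]: "num_leaves (Some (Node [])) = 1"
  by (simp add: num_leaves_def)

lemma leaves_nonempty: "leaves t \<noteq> {}"
proof (induction t)
  case (Node ts)
  show ?case
  proof (cases ts)
    case (Cons t us)
    then obtain p where "p \<in> leaves t" using Node by fastforce
    then have "0 # p \<in> leaves (Node ts)" using Cons by simp
    then show ?thesis by blast
  qed simp
qed

lemma num_leaves_pos: "num_leaves (Some t) > 0"
  by (simp add: num_leaves_def card_gt_0_iff finite_leaves leaves_nonempty)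

lemma card_leaves_isomorphic: "isomorphic t u \<Longrightarrow> card (leaves t) = card (leaves u)"
proof (induction t arbitrary: u)
  case (Node ts)
  obtain us where u: "u = Node us" by (cases u)
  obtain \<sigma> where \<sigma>: "bij_betw \<sigma> {..<length ts} {..<length us}"
    and iso: "\<And>i. i < length ts \<Longrightarrow> isomorphic (ts ! i) (us ! \<sigma> i)"
    using Node.prems isomorphic_Node unfolding u by blast
  have len: "length ts = length us" using bij_betw_same_card[OF \<sigma>] by simp
  show ?case
  proof (cases "ts = []")
    case True
    then show ?thesis using len u by simp
  next
    case False
    have "card (leaves (Node ts)) = (\<Sum>i<length ts. card (leaves (us ! \<sigma> i)))"
      unfolding card_leaves_Node[OF False]
      by (intro sum.cong refl Node.IH) (auto intro: iso)
    also have "\<dots> = (\<Sum>j<length us. card (leaves (us ! j)))"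
      by (rule sum.reindex_bij_betw[OF \<sigma>])
    also have "\<dots> = card (leaves u)"
      using False len unfolding u by (subst card_leaves_Node) auto
    finally show ?thesis .
  qed
qed

lemma num_leaves_opt_iso: "opt_iso T U \<Longrightarrow> num_leaves T = num_leaves U"
  by (cases T; cases U) (auto simp: num_leaves_def card_leaves_isomorphic)

declare branch.simps [simp del]

lemma branch_Node:
  "length ts \<le> d \<Longrightarrow> j < d \<Longrightarrow> branch d (Node ts) j = (if j < length ts then Some (ts ! j) else None)"
  by (simp add: branch.simps nth_append)

lemma num_leaves_branches:
  assumes "ts \<noteq> []" "length ts \<le> d"
  shows "num_leaves (Some (Node ts)) = (\<Sum>j<d. num_leaves (branch d (Node ts) j))"
proof -
  have "(\<Sum>j<d. num_leaves (branch d (Node ts) j))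
      = (\<Sum>j<d. if j < length ts then card (leaves (ts ! j)) else 0)"
    using assms by (intro sum.cong) (auto simp: branch_Node num_leaves_def)
  also have "\<dots> = (\<Sum>j<length ts. card (leaves (ts ! j)))"
    using assms by (intro sum.mono_neutral_cong_right) auto
  finally show ?thesis using assms by (simp add: num_leaves_def card_leaves_Node)
qed

lemma dary_branch:
  assumes "dary_nonempty d (Node ts)" "j < d" shows "dary d (branch d (Node ts) j)"
proof -
  have "length ts \<le> d" using assms by auto
  then show ?thesis using assms by (auto simp: branch_Node)
qed

lemma dary_nonempty_induct [consumes 1, case_names leaf Node]:
  assumes "dary_nonempty d t"
    and "P (Node [])"
    and "\<And>ts. 2 \<le> length ts \<Longrightarrow> length ts \<le> d \<Longrightarrow> dary_nonempty d (Node ts) \<Longrightarrow>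
      (\<And>t. t \<in> set ts \<Longrightarrow> dary_nonempty d t \<Longrightarrow> P t) \<Longrightarrow> P (Node ts)"
  shows "P t"
  using assms(1)
proof (induction t)
  case (Node ts)
  show ?case
  proof (cases "ts = []")
    case False
    then show ?thesis using Node by (intro assms(3)) auto
  qed (simp add: assms(2))
qed

subsection \<open>Induced subtrees\<close>

lemma below_subset: "S \<subseteq> leaves (Node ts) \<Longrightarrow> i < length ts \<Longrightarrow> below i S \<subseteq> leaves (ts ! i)"
  by auto

lemma leaf_subset_decomp:
  assumes "S \<subseteq> leaves (Node ts)" "ts \<noteq> []" shows "S = (\<Union>i<length ts. (#) i ` below i S)"
  using assms by (fastforce simp: leaves_Node)

lemma card_below:
  assumes "S \<subseteq> leaves (Node ts)" "ts \<noteq> []" shows "card S = (\<Sum>i<length ts. card (below i S))"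
proof -
  have fin: "finite (below i S)" if "i < length ts" for i
    using below_subset[OF assms(1) that] finite_leaves finite_subset by blast
  have "card S = card (\<Union>i<length ts. (#) i ` below i S)"
    using leaf_subset_decomp[OF assms] by simp
  also have "\<dots> = (\<Sum>i<length ts. card ((#) i ` below i S))"
    by (rule card_UN_disjoint) (auto simp: fin)
  also have "\<dots> = (\<Sum>i<length ts. card (below i S))"
    by (intro sum.cong refl card_image) (auto intro: injI)
  finally show ?thesis .
qed

lemma suppress_Node: "length ts \<noteq> 1 \<Longrightarrow> suppress (Node ts) = Node (map suppress ts)"
  by (cases ts; cases "tl ts") auto

declare prune.simps [simp del]

lemma filter_eq_singleton:
  assumes "{i \<in> set xs. P i} = {a}" "distinct xs" shows "filter P xs = [a]"
proof -
  have "set (filter P xs) = {a}" "distinct (filter P xs)" using assms by auto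
  then show ?thesis
    by (cases "filter P xs" rule: remdups_adj.cases) auto
qed

text \<open>Pruning leaves the root one child, so suppression skips the root.\<close>

lemma suppress_prune_single:
  assumes "S \<subseteq> leaves (Node ts)" "{i. below i S \<noteq> {}} = {j}"
  shows "suppress (prune (Node ts) S) = suppress (prune (ts ! j) (below j S))"
proof -
  have "{i. below i S \<noteq> {}} \<subseteq> {..<length ts}" using assms(1) by auto
  then have "{i \<in> set [0..<length ts]. below i S \<noteq> {}} = {i. below i S \<noteq> {}}" by auto
  then have "{i \<in> set [0..<length ts]. below i S \<noteq> {}} = {j}" using assms(2) by (rule trans)
  then have "filter (\<lambda>i. below i S \<noteq> {}) [0..<length ts] = [j]"
    by (rule filter_eq_singleton) simp
  then show ?thesis by (simp add: prune.simps)
qed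

lemma suppress_prune_multi:
  assumes "card {i. below i S \<noteq> {}} \<noteq> 1" "S \<subseteq> leaves (Node ts)"
  shows "suppress (prune (Node ts) S) = Node (map (\<lambda>i. suppress (prune (ts ! i) (below i S)))
      (filter (\<lambda>i. below i S \<noteq> {}) [0..<length ts]))"
proof -
  have "{i. below i S \<noteq> {}} = set (filter (\<lambda>i. below i S \<noteq> {}) [0..<length ts])"
    using assms(2) by auto
  then have "card {i. below i S \<noteq> {}} = length (filter (\<lambda>i. below i S \<noteq> {}) [0..<length ts])"
    by (metis distinct_card distinct_filter distinct_upt)
  then show ?thesis using assms(1) by (simp add: prune.simps suppress_Node comp_def)
qed

lemma nonempty_below:
  assumes "S \<subseteq> leaves (Node ts)" "ts \<noteq> []" "S \<noteq> {}" shows "{i. below i S \<noteq> {}} \<noteq> {}"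
proof -
  obtain p where "p \<in> S" using assms by blast
  moreover obtain i q where "p = i # q" using assms \<open>p \<in> S\<close> by (cases p) auto
  ultimately show ?thesis by blast
qed

text \<open>Only inner vertices are suppressed, so leaves add up over the occupied branches in the
  same way as the elements of \<open>S\<close>.\<close>

lemma card_leaves_suppress_prune:
  "S \<subseteq> leaves t \<Longrightarrow> S \<noteq> {} \<Longrightarrow> card (leaves (suppress (prune t S))) = card S"
proof (induction t arbitrary: S)
  case (Node ts)
  show ?case
  proof (cases "ts = []")
    case True
    then have "S = {[]}" using Node.prems by auto
    then show ?thesis using True by (simp add: prune.simps)
  next
    case False
    let ?I = "{i. below i S \<noteq> {}}"
    have I: "?I \<subseteq> {..<length ts}" using Node.prems by auto
    have IH: "card (leaves (suppress (prune (ts ! i) (below i S)))) = card (below i S)"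
      if "i \<in> ?I" for i
      using Node.IH[of "ts ! i" "below i S"] below_subset[OF Node.prems(1)] that I by auto
    have "card S = (\<Sum>i<length ts. card (below i S))"
      by (rule card_below[OF Node.prems(1) False])
    also have "\<dots> = (\<Sum>i\<in>?I. card (below i S))"
      using I by (intro sum.mono_neutral_right) auto
    finally have cS: "card S = (\<Sum>i\<in>?I. card (below i S))" .
    show ?thesis
    proof (cases "card ?I = 1")
      case True
      then obtain j where j: "?I = {j}" by (auto simp: card_1_singleton_iff)
      then have "j \<in> ?I" by simp
      then show ?thesis
        unfolding suppress_prune_single[OF Node.prems(1) j] cS using IH j by simp
    next
      case neq1: False
      define js where "js = filter (\<lambda>i. below i S \<noteq> {}) [0..<length ts]"
      have set_js: "set js = ?I" using I by (auto simp: js_def)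
      have "js \<noteq> []" using set_js nonempty_below[OF Node.prems(1) False Node.prems(2)] by auto
      then have "card (leaves (suppress (prune (Node ts) S)))
          = (\<Sum>k<length js. card (leaves (suppress (prune (ts ! (js ! k)) (below (js ! k) S)))))"
        unfolding suppress_prune_multi[OF neq1 Node.prems(1)] js_def[symmetric]
        by (subst card_leaves_Node) auto
      also have "\<dots> = (\<Sum>k<length js. card (below (js ! k) S))"
      proof (rule sum.cong)
        fix k assume "k \<in> {..<length js}"
        then have "js ! k \<in> ?I" using set_js nth_mem by blast
        then show "card (leaves (suppress (prune (ts ! (js ! k)) (below (js ! k) S)))) = card (below (js ! k) S)"
          by (rule IH)
      qed simp
      also have "\<dots> = (\<Sum>i\<in>?I. card (below i S))"
        using set_js by (intro sum.reindex_bij_betw bij_betw_nth) (auto simp: js_def)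
      finally show ?thesis using cS by simp
    qed
  qed
qed

lemma num_leaves_induced: "S \<subseteq> leaf_set T \<Longrightarrow> num_leaves (induced T S) = card S"
  by (cases T) (auto simp: num_leaves_def card_leaves_suppress_prune)

lemma induced_empty: "induced T {} = None"
  by (cases T) auto

lemma induced_eq_None_iff: "S \<subseteq> leaf_set T \<Longrightarrow> induced T S = None \<longleftrightarrow> S = {}"
  by (cases T) auto

section \<open>Counting the leaf sets that induce a given tree\<close>

definition copy_sets :: "rtree option \<Rightarrow> rtree option \<Rightarrow> nat list set set" where
  "copy_sets D T = {S. S \<subseteq> leaf_set T \<and> opt_iso (induced T S) D}"

text \<open>The tree induced by \<open>S\<close> has \<open>card S\<close> leaves and isomorphic
  trees have equally many, so isomorphism to \<open>D\<close> enforces the cardinality.\<close>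

lemma copies_eq_card: "copies D T = card (copy_sets D T)"
proof -
  have "card S = num_leaves D" if "S \<subseteq> leaf_set T" "opt_iso (induced T S) D" for S
    using num_leaves_induced[OF that(1)] num_leaves_opt_iso[OF that(2)] by simp
  then show ?thesis unfolding copies_def copy_sets_def by (intro arg_cong[of _ _ card]) auto
qed

lemma copies_le_choose: "copies D T \<le> num_leaves T choose num_leaves D"
proof -
  have "copies D T \<le> card {S. S \<subseteq> leaf_set T \<and> card S = num_leaves D}"
    unfolding copies_def by (rule card_mono) (auto simp: finite_leaf_set)
  then show ?thesis using n_subsets[OF finite_leaf_set[of T]] by (simp add: num_leaves_def)
qed

lemma copies_None_left [simp]: "copies None T = 1"
proof -
  have "copy_sets None T = {{}}"
    by (auto simp: copy_sets_def induced_empty induced_eq_None_iff)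
  then show ?thesis by (simp add: copies_eq_card)
qed

lemma copies_Some_None [simp]: "copies (Some D) None = 0"
  by (simp add: copies_eq_card copy_sets_def)

lemma copies_too_large: "num_leaves T < num_leaves D \<Longrightarrow> copies D T = 0"
  using copies_le_choose[of D T] by (simp add: binomial_eq_0)

lemma induced_singleton: "p \<in> leaves t \<Longrightarrow> induced (Some t) {p} = Some (Node [])"
proof (induction t arbitrary: p)
  case (Node ts)
  show ?case
  proof (cases p)
    case Nil
    then show ?thesis using Node.prems by (simp add: prune.simps)
  next
    case (Cons i q)
    have 1: "{k. below k {p} \<noteq> {}} = {i}" and 2: "below i {p} = {q}" using Cons by auto
    have "suppress (prune (Node ts) {p}) = suppress (prune (ts ! i) {q})"
      using suppress_prune_single[OF _ 1, of ts] Node.prems 2 by simp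
    moreover have "induced (Some (ts ! i)) {q} = Some (Node [])"
      using Node.prems Cons by (intro Node.IH) auto
    ultimately show ?thesis by simp
  qed
qed

lemma copies_leaf: "copies (Some (Node [])) T = num_leaves T"
proof -
  have "copy_sets (Some (Node [])) T = (\<lambda>p. {p}) ` leaf_set T" (is "?L = ?R")
  proof (intro equalityI subsetI)
    fix S assume S: "S \<in> ?L"
    then have "card S = 1"
      using num_leaves_induced[of S T] num_leaves_opt_iso[of "induced T S" "Some (Node [])"]
      by (simp add: copy_sets_def)
    then show "S \<in> ?R" using S by (auto simp: copy_sets_def card_1_singleton_iff)
  next
    fix S assume "S \<in> ?R"
    then show "S \<in> ?L"
      by (cases T) (auto simp: copy_sets_def induced_singleton isomorphic_refl simp del: induced.simps)
  qed
  moreover have "card ((\<lambda>p. {p}) ` leaf_set T) = card (leaf_set T)"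
    by (rule card_image) (auto simp: inj_on_def)
  ultimately show ?thesis by (simp add: copies_eq_card num_leaves_def)
qed

subsection \<open>The recurrence for the number of copies\<close>

text \<open>An isomorphism matches actual children only, while \<open>perm_reps\<close> and the
  recurrence use permutations of all \<open>d\<close> padded places. The leftover places on both
  sides are equally many, so any bijection between them completes \<open>\<tau>\<close>; conversely
  \<open>\<pi>\<close> is restricted to \<open>I\<close>.\<close>

lemma bij_extends_to_permutation:
  fixes d m :: nat
  assumes "I \<subseteq> {..<d}" "m \<le> d"
  shows "(\<exists>\<tau>. bij_betw \<tau> I {..<m} \<and> (\<forall>i\<in>I. R i (\<tau> i))) \<longleftrightarrow>
    (\<exists>\<pi>. \<pi> permutes {..<d} \<and> (\<forall>j<d. (j \<in> I \<longleftrightarrow> \<pi> j < m) \<and> (j \<in> I \<longrightarrow> R j (\<pi> j))))"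
    (is "?L \<longleftrightarrow> ?R")
proof
  assume ?L
  then obtain \<tau> where \<tau>: "bij_betw \<tau> I {..<m}" "\<forall>i\<in>I. R i (\<tau> i)" by (elim exE conjE)
  have fin: "finite I" by (rule finite_subset[OF assms(1)]) simp
  have "card ({..<d} - I) = card {m..<d}"
    using bij_betw_same_card[OF \<tau>(1)] assms fin by (simp add: card_Diff_subset)
  then obtain g where g: "bij_betw g ({..<d} - I) {m..<d}"
    using finite_same_card_bij[of "{..<d} - I" "{m..<d}"] by auto
  let ?h = "\<lambda>x. if x \<in> I then \<tau> x else g x"
  define \<pi> where "\<pi> x = (if x < d then ?h x else x)" for x
  have "bij_betw ?h (I \<union> ({..<d} - I)) ({..<m} \<union> {m..<d})"
    by (rule bij_betw_disjoint_Un[OF \<tau>(1) g]) auto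
  moreover have "I \<union> ({..<d} - I) = {..<d}" "{..<m} \<union> {m..<d} = {..<d}" using assms by auto
  ultimately have "bij_betw ?h {..<d} {..<d}" by simp
  then have "bij_betw \<pi> {..<d} {..<d}"
    by (rule iffD1[OF bij_betw_cong, rotated]) (simp add: \<pi>_def)
  then have "\<pi> permutes {..<d}" by (rule bij_imp_permutes) (simp add: \<pi>_def)
  moreover have "j \<in> I \<longleftrightarrow> \<pi> j < m" if "j < d" for j
    using bij_betwE[OF \<tau>(1)] bij_betwE[OF g] that by (cases "j \<in> I") (force simp: \<pi>_def)+
  moreover have "R j (\<pi> j)" if "j < d" "j \<in> I" for j
    using \<tau>(2) that by (simp add: \<pi>_def)
  ultimately show ?R by blast
next
  assume ?R
  then obtain \<pi> where \<pi>: "\<pi> permutes {..<d}"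
    and I: "\<And>j. j < d \<Longrightarrow> j \<in> I \<longleftrightarrow> \<pi> j < m" and R: "\<And>j. j < d \<Longrightarrow> j \<in> I \<Longrightarrow> R j (\<pi> j)"
    by blast
  have im: "\<pi> ` I = {..<m}"
  proof (intro equalityI subsetI)
    fix k assume k: "k \<in> {..<m}"
    then have "k \<in> \<pi> ` {..<d}" using assms(2) by (simp add: permutes_image[OF \<pi>])
    then obtain j where "j < d" "k = \<pi> j" by blast
    then show "k \<in> \<pi> ` I" using I[of j] k by simp
  next
    fix k assume "k \<in> \<pi> ` I"
    then obtain j where j: "j \<in> I" "k = \<pi> j" by blast
    then have "j < d" using assms(1) by blast
    then show "k \<in> {..<m}" using I[of j] j by simp
  qed
  have "\<forall>i\<in>I. R i (\<pi> i)"
  proof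
    fix i assume "i \<in> I"
    then show "R i (\<pi> i)" using R[of i] assms(1) by auto
  qed
  then show ?L using bij_betw_subset[OF permutes_imp_bij[OF \<pi>] assms(1) im] by blast
qed

text \<open>An empty tree is isomorphic only to an empty tree, so a matching permutation must send
  the occupied branches of \<open>ts\<close> exactly onto the actual branches of
  \<open>ds\<close>.\<close>

lemma opt_iso_branches_iff:
  assumes S: "S \<subseteq> leaves (Node ts)" and "length ts \<le> d" "length ds \<le> d"
  shows "(\<exists>\<pi>. \<pi> permutes {..<d} \<and>
      (\<forall>j<d. opt_iso (induced (branch d (Node ts) j) (below j S)) (branch d (Node ds) (\<pi> j)))) \<longleftrightarrow>
    (\<exists>\<tau>. bij_betw \<tau> {j. below j S \<noteq> {}} {..<length ds} \<and>
      (\<forall>j\<in>{j. below j S \<noteq> {}}. isomorphic (suppress (prune (ts ! j) (below j S))) (ds ! \<tau> j)))"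
    (is "?L \<longleftrightarrow> ?R")
proof -
  let ?I = "{j. below j S \<noteq> {}}"
  have I: "j < length ts" if "j \<in> ?I" for j using S that by auto
  then have sub: "?I \<subseteq> {..<d}" using assms(2) by force
  have "opt_iso (induced (branch d (Node ts) j) (below j S)) (branch d (Node ds) (\<pi> j)) \<longleftrightarrow>
      (j \<in> ?I \<longleftrightarrow> \<pi> j < length ds) \<and>
      (j \<in> ?I \<longrightarrow> isomorphic (suppress (prune (ts ! j) (below j S))) (ds ! \<pi> j))"
    if "\<pi> permutes {..<d}" "j < d" for \<pi> j
  proof -
    have "\<pi> j < d" using permutes_in_image[OF that(1), of j] that(2) by simp
    moreover have "induced (branch d (Node ts) j) (below j S) =
        (if j \<in> ?I then Some (suppress (prune (ts ! j) (below j S))) else None)"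
      using I[of j] assms that by (auto simp: branch_Node)
    ultimately show ?thesis using assms that by (simp add: branch_Node)
  qed
  then have "?L \<longleftrightarrow> (\<exists>\<pi>. \<pi> permutes {..<d} \<and> (\<forall>j<d. (j \<in> ?I \<longleftrightarrow> \<pi> j < length ds) \<and>
      (j \<in> ?I \<longrightarrow> isomorphic (suppress (prune (ts ! j) (below j S))) (ds ! \<pi> j))))"
    by blast
  also have "\<dots> \<longleftrightarrow> ?R"
    by (rule bij_extends_to_permutation[OF sub assms(3), symmetric])
  finally show ?thesis .
qed

text \<open>For nonempty \<open>S\<close>, suppression skips the root exactly when a single branch
  is occupied; otherwise the root stays and its children are matched with those of
  \<open>Node ds\<close>. A matching permutation occupies \<open>length ds \<ge> 2\<close> branches,
  which separates the two alternatives.\<close>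

lemma opt_iso_induced_Node_iff:
  assumes S: "S \<subseteq> leaves (Node ts)" and ts: "ts \<noteq> []" "length ts \<le> d"
    and ds: "2 \<le> length ds" "length ds \<le> d"
  shows "opt_iso (induced (Some (Node ts)) S) (Some (Node ds)) \<longleftrightarrow>
    (\<exists>j<d. (\<forall>i. i \<noteq> j \<longrightarrow> below i S = {}) \<and>
      opt_iso (induced (branch d (Node ts) j) (below j S)) (Some (Node ds))) \<or>
    (\<exists>\<pi>. \<pi> permutes {..<d} \<and>
      (\<forall>j<d. opt_iso (induced (branch d (Node ts) j) (below j S)) (branch d (Node ds) (\<pi> j))))"
    (is "?L \<longleftrightarrow> ?R1 \<or> ?R2")
proof -
  let ?I = "{j. below j S \<noteq> {}}"
  let ?s = "\<lambda>j. suppress (prune (ts ! j) (below j S))"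
  have I: "j < length ts" if "j \<in> ?I" for j using S that by auto
  note R2 = opt_iso_branches_iff[OF S ts(2) ds(2)]
  have cardI: "card ?I = length ds" if ?R2
    using that bij_betw_same_card unfolding R2 by fastforce
  consider "?I = {}" | j where "?I = {j}" | "card ?I \<noteq> 1" "?I \<noteq> {}"
    by (metis card_1_singleton_iff One_nat_def)
  then show ?thesis
  proof cases
    case 1
    then have S0: "S = {}" using nonempty_below[OF S ts(1)] by blast
    have "\<not> ?R2"
    proof
      assume ?R2
      from cardI[OF this] show False using 1 ds by simp
    qed
    moreover have "\<not> ?L" "\<not> ?R1" using S0 by (simp_all add: induced_empty)
    ultimately show ?thesis by blast
  next
    case (2 j)
    then have "\<not> ?R2" using cardI ds by auto
    have j: "j \<in> ?I" using 2 by simp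
    then have "S \<noteq> {}" by auto
    then have ind: "induced (Some (Node ts)) S = induced (branch d (Node ts) j) (below j S)"
      using suppress_prune_single[OF S 2] I[OF j] j ts by (simp add: branch_Node)
    have "?R1 \<longleftrightarrow> opt_iso (induced (branch d (Node ts) j) (below j S)) (Some (Node ds))"
    proof
      assume ?R1
      then obtain k where "\<forall>i. i \<noteq> k \<longrightarrow> below i S = {}"
        "opt_iso (induced (branch d (Node ts) k) (below k S)) (Some (Node ds))" by blast
      moreover have "k = j"
      proof (rule ccontr)
        assume "k \<noteq> j"
        then have "below j S = {}" using calculation(1) by simp
        then show False using j by simp
      qed
      ultimately show "opt_iso (induced (branch d (Node ts) j) (below j S)) (Some (Node ds))" by simp
    next
      assume "opt_iso (induced (branch d (Node ts) j) (below j S)) (Some (Node ds))"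
      moreover have "below i S = {}" if "i \<noteq> j" for i using 2 that by blast
      ultimately show ?R1 using I[OF j] ts by (intro exI[of _ j]) auto
    qed
    then show ?thesis using \<open>\<not> ?R2\<close> unfolding ind by blast
  next
    case 3
    have "\<not> ?R1"
    proof
      assume ?R1
      then obtain j where "\<forall>i. i \<noteq> j \<longrightarrow> below i S = {}" by blast
      then have "?I \<subseteq> {j}" by blast
      then show False using 3 by (auto simp: subset_singleton_iff)
    qed
    moreover have "?L \<longleftrightarrow> ?R2"
    proof -
      define js where "js = filter (\<lambda>i. below i S \<noteq> {}) [0..<length ts]"
      have set_js: "set js = ?I" using I by (auto simp: js_def)
      have js: "bij_betw ((!) js) {..<length js} ?I"
        using set_js by (intro bij_betw_nth) (auto simp: js_def)
      have "S \<noteq> {}" using 3 by auto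
      then have "?L \<longleftrightarrow> isomorphic (Node (map ?s js)) (Node ds)"
        using suppress_prune_multi[OF 3(1) S] by (simp add: js_def)
      also have "\<dots> \<longleftrightarrow> (\<exists>\<sigma>. bij_betw \<sigma> {..<length js} {..<length ds} \<and>
          (\<forall>k<length js. isomorphic (?s (js ! k)) (ds ! \<sigma> k)))"
        by (subst isomorphic_Node) simp
      also have "\<dots> \<longleftrightarrow> (\<exists>\<tau>. bij_betw \<tau> ?I {..<length ds} \<and> (\<forall>j\<in>?I. isomorphic (?s j) (ds ! \<tau> j)))"
        (is "?A \<longleftrightarrow> ?B")
      proof
        assume ?A
        then obtain \<sigma> where \<sigma>: "bij_betw \<sigma> {..<length js} {..<length ds}"
          "\<forall>k<length js. isomorphic (?s (js ! k)) (ds ! \<sigma> k)" by blast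
        let ?inv = "the_inv_into {..<length js} ((!) js)"
        have inv: "bij_betw ?inv ?I {..<length js}" by (rule bij_betw_the_inv_into[OF js])
        have "js ! ?inv j = j" if "j \<in> ?I" for j
          by (rule f_the_inv_into_f_bij_betw[OF js]) (use that in blast)
        then have "\<forall>j\<in>?I. isomorphic (?s j) (ds ! (\<sigma> \<circ> ?inv) j)"
          using \<sigma>(2) bij_betwE[OF inv] by force
        then show ?B using bij_betw_trans[OF inv \<sigma>(1)] by blast
      next
        assume ?B
        then obtain \<tau> where \<tau>: "bij_betw \<tau> ?I {..<length ds}" "\<forall>j\<in>?I. isomorphic (?s j) (ds ! \<tau> j)"
          by blast
        have "\<forall>k<length js. isomorphic (?s (js ! k)) (ds ! (\<tau> \<circ> (!) js) k)"
          using \<tau>(2) bij_betwE[OF js] by simp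
        then show ?A using bij_betw_trans[OF js \<tau>(1)] by blast
      qed
      finally show ?thesis unfolding R2 .
    qed
    ultimately show ?thesis by blast
  qed
qed

text \<open>Here \<open>\<pi> j\<close> is the branch of \<open>D\<close> placed in branch
  \<open>j\<close> of \<open>T\<close>. A set with one match has several as soon as \<open>D\<close>
  has isomorphic branches, empty ones included; \<open>branch_stabiliser\<close> measures this
  multiplicity.\<close>

definition branch_matches :: "nat \<Rightarrow> rtree \<Rightarrow> rtree \<Rightarrow> (nat \<Rightarrow> nat) \<Rightarrow> nat list set set" where
  "branch_matches d D T \<pi> = {S. S \<subseteq> leaves T \<and>
     (\<forall>j<d. opt_iso (induced (branch d T j) (below j S)) (branch d D (\<pi> j)))}"

lemma below_subset_branch:
  "S \<subseteq> leaves (Node ts) \<Longrightarrow> length ts \<le> d \<Longrightarrow> j < d \<Longrightarrow>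
    below j S \<subseteq> leaf_set (branch d (Node ts) j)"
  by (auto simp: branch_Node)

lemma eq_if_below_eq:
  assumes "S \<subseteq> leaves (Node ts)" "S' \<subseteq> leaves (Node ts)" "ts \<noteq> []"
    "\<And>i. i < length ts \<Longrightarrow> below i S = below i S'"
  shows "S = S'"
  using leaf_subset_decomp[OF assms(1,3)] leaf_subset_decomp[OF assms(2,3)] assms(4) by simp

text \<open>A leaf set is determined by its parts in the branches, and the conditions on these parts
  are independent of one another.\<close>

lemma card_branch_matches:
  assumes "ts \<noteq> []" "length ts \<le> d"
  shows "card (branch_matches d D (Node ts) \<pi>) =
    (\<Prod>j<d. copies (branch d D (\<pi> j)) (branch d (Node ts) j))"
proof -
  let ?f = "\<lambda>S. restrict (\<lambda>j. below j S) {..<d}"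
  let ?P = "\<Pi>\<^sub>E j\<in>{..<d}. copy_sets (branch d D (\<pi> j)) (branch d (Node ts) j)"
  have "bij_betw ?f (branch_matches d D (Node ts) \<pi>) ?P"
    unfolding bij_betw_def
  proof
    show "inj_on ?f (branch_matches d D (Node ts) \<pi>)"
    proof (rule inj_onI)
      fix S S' assume S: "S \<in> branch_matches d D (Node ts) \<pi>" "S' \<in> branch_matches d D (Node ts) \<pi>"
        and eq: "?f S = ?f S'"
      have "below i S = below i S'" if "i < length ts" for i
        using fun_cong[OF eq, of i] that assms(2) by simp
      then show "S = S'" using S assms(1) by (intro eq_if_below_eq[of S ts]) (auto simp: branch_matches_def)
    qed
    show "?f ` branch_matches d D (Node ts) \<pi> = ?P"
    proof (intro equalityI subsetI)
      fix F assume "F \<in> ?f ` branch_matches d D (Node ts) \<pi>"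
      then obtain S where S: "S \<in> branch_matches d D (Node ts) \<pi>" "F = ?f S" by (rule imageE)
      have "below j S \<in> copy_sets (branch d D (\<pi> j)) (branch d (Node ts) j)" if "j < d" for j
        using S(1) below_subset_branch[OF _ assms(2) that, of S] that
        by (simp add: branch_matches_def copy_sets_def)
      then show "F \<in> ?P" unfolding S(2) by (intro restrict_PiE_iff[THEN iffD2]) auto
    next
      fix F assume F: "F \<in> ?P"
      define S where "S = (\<Union>j<d. (#) j ` F j)"
      have below: "below j S = F j" if "j < d" for j using that by (auto simp: S_def)
      have copy: "F j \<in> copy_sets (branch d D (\<pi> j)) (branch d (Node ts) j)" if "j < d" for j
        using PiE_mem[OF F, of j] that by simp
      have "S \<subseteq> leaves (Node ts)"
      proof
        fix v assume "v \<in> S"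
        then obtain j p where v: "v = j # p" "j < d" "p \<in> F j" by (auto simp: S_def)
        then have "p \<in> leaf_set (branch d (Node ts) j)" using copy[of j] by (auto simp: copy_sets_def)
        then show "v \<in> leaves (Node ts)"
          using v assms by (auto simp: branch_Node split: if_splits)
      qed
      then have "S \<in> branch_matches d D (Node ts) \<pi>"
        using copy below by (auto simp: branch_matches_def copy_sets_def)
      moreover have "?f S = F"
      proof
        fix j show "?f S j = F j" using below[of j] PiE_arb[OF F, of j] by (cases "j < d") simp_all
      qed
      ultimately show "F \<in> ?f ` branch_matches d D (Node ts) \<pi>" by blast
    qed
  qed
  from bij_betw_same_card[OF this] show ?thesis
    by (simp add: card_PiE copies_eq_card)
qed

lemma card_single_branch_copies:
  assumes "ts \<noteq> []" "length ts \<le> d" "j < d"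
  shows "card {S. S \<subseteq> leaves (Node ts) \<and> (\<forall>i. i \<noteq> j \<longrightarrow> below i S = {}) \<and>
      opt_iso (induced (branch d (Node ts) j) (below j S)) D} = copies D (branch d (Node ts) j)"
    (is "card ?X = _")
proof -
  let ?f = "\<lambda>F. (#) j ` F"
  have "?X = ?f ` copy_sets D (branch d (Node ts) j)"
  proof (intro equalityI subsetI)
    fix S assume S: "S \<in> ?X"
    have "S = ?f (below j S)"
    proof (intro set_eqI)
      fix v show "v \<in> S \<longleftrightarrow> v \<in> ?f (below j S)" using S assms(1) by (cases v) auto
    qed
    moreover have "below j S \<in> copy_sets D (branch d (Node ts) j)"
      using S below_subset_branch[of S ts d j] assms by (simp add: copy_sets_def)
    ultimately show "S \<in> ?f ` copy_sets D (branch d (Node ts) j)" by blast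
  next
    fix S assume "S \<in> ?f ` copy_sets D (branch d (Node ts) j)"
    then obtain F where F: "F \<in> copy_sets D (branch d (Node ts) j)" "S = ?f F" by blast
    have "below j S = F" "below i S = {}" if "i \<noteq> j" for i using F(2) that by auto
    moreover have "S \<subseteq> leaves (Node ts)"
      using F assms by (auto simp: copy_sets_def branch_Node split: if_splits)
    moreover have "below j S = F" using F(2) by auto
    ultimately show "S \<in> ?X" using F(1) by (simp add: copy_sets_def)
  qed
  moreover have "card (?f ` copy_sets D (branch d (Node ts) j)) = card (copy_sets D (branch d (Node ts) j))"
    by (rule card_image) (auto simp: inj_on_def)
  ultimately show ?thesis by (simp add: copies_eq_card)
qed

text \<open>Composition with \<open>\<pi>\<close> on the right carries the second set onto the
  first. This gives both the size of a class of \<open>perm_rel\<close> and the number of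
  permutations matching a given leaf set.\<close>

lemma card_permutation_coset:
  assumes "\<pi> permutes {..<d::nat}"
  shows "card {\<rho>. \<rho> permutes {..<d} \<and> (\<forall>j<d. R (\<rho> j) (\<pi> j))} =
    card {\<tau>. \<tau> permutes {..<d} \<and> (\<forall>j<d. R (\<tau> j) j)}" (is "card ?A = card ?B")
proof -
  have inv: "inv \<pi> permutes {..<d}" by (rule permutes_inv[OF assms])
  have "bij_betw (\<lambda>\<tau>. \<tau> \<circ> \<pi>) ?B ?A"
  proof (rule bij_betw_byWitness[where f' = "\<lambda>\<rho>. \<rho> \<circ> inv \<pi>"])
    show "\<forall>\<tau>\<in>?B. (\<tau> \<circ> \<pi>) \<circ> inv \<pi> = \<tau>" "\<forall>\<rho>\<in>?A. (\<rho> \<circ> inv \<pi>) \<circ> \<pi> = \<rho>"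
      using permutes_inv_o[OF assms] by (auto simp: comp_assoc)
    show "(\<lambda>\<tau>. \<tau> \<circ> \<pi>) ` ?B \<subseteq> ?A"
    proof (intro subsetI)
      fix \<rho> assume "\<rho> \<in> (\<lambda>\<tau>. \<tau> \<circ> \<pi>) ` ?B"
      then obtain \<tau> where \<tau>: "\<tau> permutes {..<d}" "\<forall>j<d. R (\<tau> j) j" "\<rho> = \<tau> \<circ> \<pi>" by blast
      then show "\<rho> \<in> ?A" using permutes_in_image[OF assms] permutes_compose[OF assms \<tau>(1)] by simp
    qed
    show "(\<lambda>\<rho>. \<rho> \<circ> inv \<pi>) ` ?A \<subseteq> ?B"
    proof (intro subsetI)
      fix \<tau> assume "\<tau> \<in> (\<lambda>\<rho>. \<rho> \<circ> inv \<pi>) ` ?A"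
      then obtain \<rho> where \<rho>: "\<rho> permutes {..<d}" "\<forall>j<d. R (\<rho> j) (\<pi> j)" "\<tau> = \<rho> \<circ> inv \<pi>" by blast
      have "R (\<tau> j) j" if "j < d" for j
      proof -
        have "inv \<pi> j < d" using permutes_in_image[OF inv, of j] that by simp
        then have "R (\<rho> (inv \<pi> j)) (\<pi> (inv \<pi> j))" using \<rho>(2) by blast
        then show ?thesis using \<rho>(3) permutes_inverses(1)[OF assms, of j] by simp
      qed
      then show "\<tau> \<in> ?B" using \<rho>(3) permutes_compose[OF inv \<rho>(1)] by simp
    qed
  qed
  from bij_betw_same_card[OF this] show ?thesis by (rule sym)
qed

text \<open>This is the class of the identity under \<open>perm_rel\<close>: the stabiliser of the
  list of branches taken up to isomorphism.\<close>

abbreviation branch_stabiliser :: "nat \<Rightarrow> rtree \<Rightarrow> (nat \<Rightarrow> nat) set" where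
  "branch_stabiliser d D \<equiv>
     {\<tau>. \<tau> permutes {..<d} \<and> (\<forall>j<d. opt_iso (branch d D (\<tau> j)) (branch d D j))}"

text \<open>Orbit-stabiliser: every class of \<open>perm_rel\<close> is as large as that of the
  identity, and together they make up all \<open>d!\<close> permutations. Representatives of
  different classes differ because the classes are disjoint.\<close>

lemma card_stabiliser_times_reps: "card (branch_stabiliser d D) * card (perm_reps d D) = fact d"
proof -
  let ?P = "{\<pi>. \<pi> permutes {..<d}}" and ?R = "perm_rel d D"
  have equiv: "equiv ?P ?R"
  proof (rule equivI)
    show "?R \<subseteq> ?P \<times> ?P" by (auto simp: perm_rel_def)
    show "refl_on ?P ?R" by (auto simp: refl_on_def perm_rel_def intro: opt_iso_refl)
    show "sym ?R" by (auto simp: sym_def perm_rel_def intro: opt_iso_sym)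
    show "trans ?R" by (auto simp: trans_def perm_rel_def intro: opt_iso_trans)
  qed
  have fin: "finite ?P" by (rule finite_permutations) simp
  have "inj_on (\<lambda>C. SOME \<pi>. \<pi> \<in> C) (?P // ?R)"
  proof (rule inj_onI)
    fix A B assume A: "A \<in> ?P // ?R" and B: "B \<in> ?P // ?R"
      and eq: "(SOME \<pi>. \<pi> \<in> A) = (SOME \<pi>. \<pi> \<in> B)"
    have "(SOME \<pi>. \<pi> \<in> A) \<in> A" "(SOME \<pi>. \<pi> \<in> B) \<in> B"
      using in_quotient_imp_non_empty[OF equiv] A B by (auto intro: some_in_eq[THEN iffD2])
    then show "A = B" using quotient_disj[OF equiv A B] eq by auto
  qed
  then have reps: "card (perm_reps d D) = card (?P // ?R)"
    unfolding perm_reps_def by (rule card_image)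
  have "card C = card (branch_stabiliser d D)" if C: "C \<in> ?P // ?R" for C
  proof -
    obtain \<pi> where \<pi>: "\<pi> permutes {..<d}" "C = ?R `` {\<pi>}" using C by (auto elim: quotientE)
    have "C = {\<rho>. \<rho> permutes {..<d} \<and> (\<forall>j<d. opt_iso (branch d D (\<rho> j)) (branch d D (\<pi> j)))}"
      using \<pi> by (auto simp: perm_rel_def intro: opt_iso_sym)
    then show ?thesis
      using card_permutation_coset[OF \<pi>(1), of "\<lambda>a b. opt_iso (branch d D a) (branch d D b)"] by simp
  qed
  moreover have "A \<inter> B = {}" if "A \<in> ?P // ?R" "B \<in> ?P // ?R" "A \<noteq> B" for A B
    using quotient_disj[OF equiv that(1,2)] that(3) by blast
  moreover have "finite (?P // ?R)" "\<Union> (?P // ?R) = ?P"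
    using fin Union_quotient[OF equiv] finite_quotient[OF fin] equiv_type[OF equiv] by auto
  ultimately have "card (branch_stabiliser d D) * card (?P // ?R) = card ?P"
    using fin card_partition[of "?P // ?R" "card (branch_stabiliser d D)"] by auto
  then show ?thesis using reps card_permutations[of "{..<d}" d] by simp
qed

text \<open>Sets inside a single branch are counted directly. The others are counted as pairs
  \<open>(S, \<pi>)\<close> of a set and a matching permutation; each \<open>S\<close> occurs once
  for every element of the stabiliser, and \<open>|M(D)| / d!\<close> is the reciprocal of the
  stabiliser's size.\<close>

lemma copies_recurrence:
  assumes ts: "ts \<noteq> []" "length ts \<le> d" and ds: "2 \<le> length ds" "length ds \<le> d"
  shows "real (copies (Some (Node ds)) (Some (Node ts))) =
    (\<Sum>j<d. real (copies (Some (Node ds)) (branch d (Node ts) j))) +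
    real (card (perm_reps d (Node ds))) / fact d *
      (\<Sum>\<pi> | \<pi> permutes {..<d}. \<Prod>i<d. real (copies (branch d (Node ds) i) (branch d (Node ts) (\<pi> i))))"
proof -
  let ?D = "Node ds" and ?T = "Node ts" and ?P = "{\<pi>. \<pi> permutes {..<d}}"
  let ?M = "branch_matches d ?D ?T"
  define X where "X j = {S. S \<subseteq> leaves ?T \<and> (\<forall>i. i \<noteq> j \<longrightarrow> below i S = {}) \<and>
      opt_iso (induced (branch d ?T j) (below j S)) (Some ?D)}" for j
  have fin: "finite ?P" by (rule finite_permutations) simp
  have finX: "finite (X j)" for j
    by (rule finite_subset[of _ "Pow (leaves ?T)"]) (auto simp: X_def finite_leaves)
  have finM: "finite (?M \<pi>)" for \<pi>
    by (rule finite_subset[of _ "Pow (leaves ?T)"]) (auto simp: branch_matches_def finite_leaves)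
  have "copy_sets (Some ?D) (Some ?T) = (\<Union>j<d. X j) \<union> (\<Union>\<pi>\<in>?P. ?M \<pi>)"
  proof (intro set_eqI)
    fix S show "S \<in> copy_sets (Some ?D) (Some ?T) \<longleftrightarrow> S \<in> (\<Union>j<d. X j) \<union> (\<Union>\<pi>\<in>?P. ?M \<pi>)"
    proof (cases "S \<subseteq> leaves ?T")
      case True
      show ?thesis
        using True opt_iso_induced_Node_iff[OF True ts ds]
        by (simp add: copy_sets_def X_def branch_matches_def Bex_def del: induced.simps)
    qed (auto simp: copy_sets_def X_def branch_matches_def)
  qed
  moreover have "(\<Union>j<d. X j) \<inter> (\<Union>\<pi>\<in>?P. ?M \<pi>) = {}"
  proof -
    \<comment> \<open>A set in \<open>X j\<close> occupies at most one branch, a matched set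
      occupies \<open>length ds \<ge> 2\<close> of them.\<close>
    have False if "S \<in> X j" "\<pi> permutes {..<d}" "S \<in> ?M \<pi>" for S j \<pi>
    proof -
      have S: "S \<subseteq> leaves ?T" using that(1) by (simp add: X_def)
      have "\<exists>\<tau>. bij_betw \<tau> {j. below j S \<noteq> {}} {..<length ds}"
        using opt_iso_branches_iff[OF S ts(2) ds(2)] that by (auto simp: branch_matches_def)
      then have "card {j. below j S \<noteq> {}} = length ds" by (auto dest: bij_betw_same_card)
      moreover have "{j. below j S \<noteq> {}} \<subseteq> {j}" using that(1) by (auto simp: X_def)
      then have "card {j. below j S \<noteq> {}} \<le> 1" using card_mono[of "{j}"] by fastforce
      ultimately show False using ds by simp
    qed
    then show ?thesis by blast
  qed
  ultimately have split: "copies (Some ?D) (Some ?T) = card (\<Union>j<d. X j) + card (\<Union>\<pi>\<in>?P. ?M \<pi>)"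
    using finX finM fin by (simp add: copies_eq_card card_Un_disjoint)
  have "card (\<Union>j<d. X j) = (\<Sum>j<d. card (X j))"
  proof (rule card_UN_disjoint)
    show "\<forall>i\<in>{..<d}. \<forall>j\<in>{..<d}. i \<noteq> j \<longrightarrow> X i \<inter> X j = {}"
    proof (intro ballI impI)
      fix i j :: nat assume "i \<noteq> j"
      have False if "S \<in> X i" "S \<in> X j" for S
      proof -
        \<comment> \<open>Such an \<open>S\<close> would have an empty part in every branch, but the
          empty set induces \<open>None\<close> and not \<open>Some ?D\<close>.\<close>
        have "below k S = {}" for k using that \<open>i \<noteq> j\<close> by (cases "k = i") (auto simp: X_def)
        then show False using that by (simp add: X_def induced_empty)
      qed
      then show "X i \<inter> X j = {}" by blast
    qed
  qed (use finX in auto)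
  also have "\<dots> = (\<Sum>j<d. copies (Some ?D) (branch d ?T j))"
    using card_single_branch_copies[OF ts] by (simp add: X_def)
  finally have first: "card (\<Union>j<d. X j) = (\<Sum>j<d. copies (Some ?D) (branch d ?T j))" .
  \<comment> \<open>Double counting of the pairs \<open>(S, \<pi>)\<close> with
    \<open>S \<in> ?M \<pi>\<close>.\<close>
  have "(\<Sum>\<pi>\<in>?P. card {S \<in> (\<Union>\<pi>\<in>?P. ?M \<pi>). S \<in> ?M \<pi>}) =
      card (branch_stabiliser d ?D) * card (\<Union>\<pi>\<in>?P. ?M \<pi>)"
  proof (rule sum_multicount)
    show "\<forall>S\<in>(\<Union>\<pi>\<in>?P. ?M \<pi>). card {\<pi> \<in> ?P. S \<in> ?M \<pi>} = card (branch_stabiliser d ?D)"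
    proof
      fix S assume "S \<in> (\<Union>\<pi>\<in>?P. ?M \<pi>)"
      then obtain \<pi> where \<pi>: "\<pi> permutes {..<d}" "S \<in> ?M \<pi>" by blast
      have "{\<rho> \<in> ?P. S \<in> ?M \<rho>} =
          {\<rho>. \<rho> permutes {..<d} \<and> (\<forall>j<d. opt_iso (branch d ?D (\<rho> j)) (branch d ?D (\<pi> j)))}"
        using \<pi>(2) unfolding branch_matches_def by (blast intro: opt_iso_sym opt_iso_trans)
      then show "card {\<rho> \<in> ?P. S \<in> ?M \<rho>} = card (branch_stabiliser d ?D)"
        using card_permutation_coset[OF \<pi>(1), of "\<lambda>a b. opt_iso (branch d ?D a) (branch d ?D b)"]
        by simp
    qed
  qed (use fin finM in auto)
  moreover have "{S \<in> (\<Union>\<pi>\<in>?P. ?M \<pi>). S \<in> ?M \<pi>} = ?M \<pi>" if "\<pi> \<in> ?P" for \<pi> using that by blast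
  ultimately have "card (branch_stabiliser d ?D) * card (\<Union>\<pi>\<in>?P. ?M \<pi>) =
      (\<Sum>\<pi>\<in>?P. \<Prod>j<d. copies (branch d ?D (\<pi> j)) (branch d ?T j))"
    using card_branch_matches[OF ts] by simp
  \<comment> \<open>Inverting the permutations makes the product run over the branches of
    \<open>D\<close>, whose leaf numbers later become the exponents of a symmetric sum.\<close>
  also have "\<dots> = (\<Sum>\<pi>\<in>?P. \<Prod>j<d. copies (branch d ?D (inv \<pi> j)) (branch d ?T j))"
    by (rule sum_permutations_inverse)
  also have "\<dots> = (\<Sum>\<pi>\<in>?P. \<Prod>i<d. copies (branch d ?D i) (branch d ?T (\<pi> i)))"
  proof (rule sum.cong)
    fix \<pi> assume "\<pi> \<in> ?P"
    then have \<pi>: "\<pi> permutes {..<d}" by simp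
    show "(\<Prod>j<d. copies (branch d ?D (inv \<pi> j)) (branch d ?T j)) =
        (\<Prod>i<d. copies (branch d ?D i) (branch d ?T (\<pi> i)))"
      using prod.reindex_bij_betw[OF permutes_imp_bij[OF \<pi>],
          of "\<lambda>j. copies (branch d ?D (inv \<pi> j)) (branch d ?T j)"] permutes_inverses(2)[OF \<pi>]
      by simp
  qed simp
  finally have N: "card (branch_stabiliser d ?D) * card (\<Union>\<pi>\<in>?P. ?M \<pi>) =
      (\<Sum>\<pi>\<in>?P. \<Prod>i<d. copies (branch d ?D i) (branch d ?T (\<pi> i)))" (is "_ = ?s") .
  have fact: "real (card (branch_stabiliser d ?D)) * real (card (perm_reps d ?D)) = fact d"
    unfolding of_nat_mult[symmetric] card_stabiliser_times_reps by (rule of_nat_fact)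
  define u where "u = real (card (\<Union>\<pi>\<in>?P. ?M \<pi>))"
  have s: "real ?s = real (card (branch_stabiliser d ?D)) * u"
    unfolding u_def N[symmetric] by (rule of_nat_mult)
  have "u * fact d = real (card (perm_reps d ?D)) * real ?s"
    unfolding fact[symmetric] s by (simp only: mult_ac)
  then have "u = real (card (perm_reps d ?D)) / fact d * real ?s"
    by (simp add: field_simps)
  then show ?thesis
    unfolding split first of_nat_add u_def[symmetric] by simp
qed

lemma num_leaves_Node_ge: "length ts \<le> num_leaves (Some (Node ts))"
proof (cases "ts = []")
  case False
  have "(\<Sum>i<length ts. 1) \<le> (\<Sum>i<length ts. card (leaves (ts ! i)))"
    using num_leaves_pos by (intro sum_mono) (simp add: num_leaves_def Suc_le_eq)
  then show ?thesis using False by (simp add: num_leaves_def card_leaves_Node)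
qed simp

subsection \<open>Replacing every leaf by a copy of a tree\<close>

fun graft :: "rtree \<Rightarrow> rtree \<Rightarrow> rtree" where
  "graft R (Node ts) = (if ts = [] then R else Node (map (graft R) ts))"

lemma num_leaves_graft: "num_leaves (Some (graft R t)) = num_leaves (Some R) * num_leaves (Some t)"
proof (induction t)
  case (Node ts)
  show ?case
  proof (cases "ts = []")
    case False
    then show ?thesis using Node
      by (simp add: num_leaves_def card_leaves_Node sum_distrib_left)
  qed simp
qed

lemma dary_graft: "dary_nonempty d R \<Longrightarrow> dary_nonempty d t \<Longrightarrow> dary_nonempty d (graft R t)"
  by (induction t) auto

lemma branch_graft:
  "length ts \<le> d \<Longrightarrow> j < d \<Longrightarrow>
    branch d (Node (map (graft R) ts)) j = map_option (graft R) (branch d (Node ts) j)"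
  by (simp add: branch_Node)

lemma dary_option_cases [consumes 1, case_names None leaf Node]:
  assumes "dary d D"
  obtains "D = None" | "D = Some (Node [])"
    | ds where "D = Some (Node ds)" "2 \<le> length ds" "length ds \<le> d" "dary_nonempty d (Node ds)"
proof (cases D)
  case (Some D')
  then show ?thesis using assms that by (cases D') auto
qed (use that in blast)

text \<open>Each leaf of a copy can be replaced by any leaf of the \<open>R\<close> grafted there.
  Instead of constructing these sets, the proof scales the recurrence term by term: the leaf numbers
  of the branches of \<open>D\<close> add up to that of \<open>D\<close>, so the power distributes
  over the product.\<close>

lemma copies_graft:
  assumes "dary_nonempty d t" "dary d D"
  shows "real (num_leaves (Some R)) ^ num_leaves D * real (copies D (Some t))
    \<le> real (copies D (Some (graft R t)))"
  using assms
proof (induction t arbitrary: D rule: dary_nonempty_induct)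
  case (leaf D)
  from leaf(1) show ?case
  proof (cases rule: dary_option_cases)
    case (Node ds)
    then have "copies D (Some (Node [])) = 0"
      using num_leaves_Node_ge[of ds] by (intro copies_too_large) simp
    then show ?thesis by simp
  qed (simp_all add: copies_leaf)
next
  case (Node ts D)
  let ?m = "real (num_leaves (Some R))"
  have ts: "ts \<noteq> []" using Node.hyps(1) by auto
  have IH: "?m ^ num_leaves E * real (copies E (branch d (Node ts) j))
      \<le> real (copies E (map_option (graft R) (branch d (Node ts) j)))"
    if "dary d E" "j < d" for E j
  proof (cases "j < length ts")
    case True
    then show ?thesis
      using Node.IH[of "ts ! j" E] Node.hyps that by (simp add: branch_Node)
  next
    case False
    then show ?thesis using Node.hyps that by (cases E) (simp_all add: branch_Node)
  qed
  from Node.prems show ?case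
  proof (cases rule: dary_option_cases)
    case leaf
    then show ?thesis using num_leaves_graft[of R "Node ts"] by (simp add: copies_leaf del: graft.simps)
  next
    case D: (Node ds)
    have ds: "ds \<noteq> []" using D(2) by auto
    let ?b = "branch d (Node ts)" and ?D = "branch d (Node ds)" and ?G = "map_option (graft R)"
    have "?m ^ num_leaves D * real (copies D (Some (Node ts))) =
        (\<Sum>j<d. ?m ^ num_leaves D * real (copies D (?b j))) +
        real (card (perm_reps d (Node ds))) / fact d *
          (\<Sum>\<pi> | \<pi> permutes {..<d}. ?m ^ num_leaves D * (\<Prod>i<d. real (copies (?D i) (?b (\<pi> i)))))"
      unfolding D(1) copies_recurrence[OF ts Node.hyps(2) D(2,3)]
      by (simp add: algebra_simps sum_distrib_left)
    also have "\<dots> \<le> (\<Sum>j<d. real (copies D (?G (?b j)))) +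
        real (card (perm_reps d (Node ds))) / fact d *
          (\<Sum>\<pi> | \<pi> permutes {..<d}. \<Prod>i<d. real (copies (?D i) (?G (?b (\<pi> i)))))"
    proof (intro add_mono mult_left_mono sum_mono)
      fix \<pi> assume "\<pi> \<in> {\<pi>. \<pi> permutes {..<d}}"
      then have \<pi>: "\<pi> i < d" if "i < d" for i using permutes_in_image[of \<pi> "{..<d}" i] that by simp
      have "?m ^ num_leaves D = (\<Prod>i<d. ?m ^ num_leaves (?D i))"
        unfolding D(1) num_leaves_branches[OF ds D(3)] by (rule power_sum)
      then have "?m ^ num_leaves D * (\<Prod>i<d. real (copies (?D i) (?b (\<pi> i))))
          = (\<Prod>i<d. ?m ^ num_leaves (?D i) * real (copies (?D i) (?b (\<pi> i))))"
        by (simp add: prod.distrib)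
      also have "\<dots> \<le> (\<Prod>i<d. real (copies (?D i) (?G (?b (\<pi> i)))))"
        using \<pi> dary_branch[OF D(4)] by (intro prod_mono) (auto intro: IH)
      finally show "?m ^ num_leaves D * (\<Prod>i<d. real (copies (?D i) (?b (\<pi> i))))
          \<le> (\<Prod>i<d. real (copies (?D i) (?G (?b (\<pi> i)))))" .
    qed (auto intro: IH Node.prems)
    also have "\<dots> = real (copies D (Some (Node (map (graft R) ts))))"
    proof -
      let ?b' = "branch d (Node (map (graft R) ts))"
      have "(\<Sum>j<d. real (copies D (?G (?b j)))) = (\<Sum>j<d. real (copies D (?b' j)))"
        using Node.hyps(2) by (intro sum.cong refl) (simp add: branch_graft)
      moreover have "(\<Sum>\<pi> | \<pi> permutes {..<d}. \<Prod>i<d. real (copies (?D i) (?G (?b (\<pi> i))))) =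
          (\<Sum>\<pi> | \<pi> permutes {..<d}. \<Prod>i<d. real (copies (?D i) (?b' (\<pi> i))))"
      proof (intro sum.cong prod.cong refl)
        fix \<pi> i assume "\<pi> \<in> {\<pi>. \<pi> permutes {..<d}}" "i \<in> {..<d}"
        then have "\<pi> i < d" using permutes_in_image[of \<pi> "{..<d}" i] by simp
        then show "real (copies (?D i) (?G (?b (\<pi> i)))) = real (copies (?D i) (?b' (\<pi> i)))"
          using Node.hyps(2) by (simp add: branch_graft)
      qed
      moreover have "map (graft R) ts \<noteq> []" "length (map (graft R) ts) \<le> d"
        using ts Node.hyps(2) by simp_all
      ultimately show ?thesis using copies_recurrence[OF _ _ D(2,3)] unfolding D(1) by simp
    qed
    finally show ?thesis using ts by simp
  qed simp
qed

subsection \<open>Densities and inducibility\<close>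

text \<open>Caterpillars do this. They make the sets under \<open>Max\<close> nonempty for positive
  \<open>n\<close> and supply a tree of every size to graft.\<close>

lemma ex_dary_tree:
  assumes "2 \<le> d" "1 \<le> n"
  shows "\<exists>t. dary_nonempty d t \<and> num_leaves (Some t) = n"
  using assms(2)
proof (induction n rule: dec_induct)
  case base
  show ?case by (rule exI[of _ "Node []"]) simp
next
  case (step n)
  then obtain t where "dary_nonempty d t" "num_leaves (Some t) = n" by blast
  then show ?case using assms(1)
    by (intro exI[of _ "Node [Node [], t]"])
      (simp add: num_leaves_def card_leaves_Node lessThan_Suc)
qed

lemma ex_dary_trees:
  assumes "2 \<le> d"
  obtains t where "\<And>n. dary_nonempty d (t n)" "\<And>n. num_leaves (Some (t n)) = Suc n"
proof -
  have "\<exists>t. \<forall>n. dary_nonempty d (t n) \<and> num_leaves (Some (t n)) = Suc n"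
    by (intro choice allI ex_dary_tree[OF assms]) simp
  then show thesis using that by blast
qed

lemma choose_over_power_tendsto: "(\<lambda>n. real (n choose k) / real n ^ k) \<longlonglongrightarrow> 1 / fact k"
proof -
  have "(\<lambda>n. (\<Prod>i<k. 1 - real i * (1 / real n)) / fact k) \<longlonglongrightarrow> (\<Prod>i<k. 1 - real i * 0) / fact k"
    by (intro tendsto_intros lim_1_over_n) simp
  moreover have "eventually (\<lambda>n. (\<Prod>i<k. 1 - real i * (1 / real n)) / fact k
      = real (n choose k) / real n ^ k) sequentially"
    using eventually_gt_at_top[of 0]
  proof eventually_elim
    case (elim n)
    have "real (n choose k) = (\<Prod>i<k. real n - real i) / fact k"
      by (simp add: binomial_gbinomial gbinomial_prod_rev lessThan_atLeast0)
    moreover have "(\<Prod>i<k. 1 - real i * (1 / real n)) = (\<Prod>i<k. (real n - real i) / real n)"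
      using elim by (intro prod.cong) (auto simp: field_simps)
    then have "(\<Prod>i<k. 1 - real i * (1 / real n)) = (\<Prod>i<k. real n - real i) / real n ^ k"
      by (simp add: prod_dividef)
    ultimately show ?case by simp
  qed
  ultimately show ?thesis by (simp add: filterlim_cong tendsto_cong)
qed

lemma power_over_choose_tendsto: "(\<lambda>n. real n ^ k / real (n choose k)) \<longlonglongrightarrow> fact k"
  using tendsto_inverse[OF choose_over_power_tendsto[of k]] by (simp add: inverse_eq_divide)

lemma density_nonneg: "0 \<le> density D T"
  by (simp add: density_def)

lemma density_le_1: "density D T \<le> 1"
  using copies_le_choose[of D T] by (auto simp: density_def divide_le_eq_1)

text \<open>For fixed \<open>n\<close> all densities share one denominator, which also bounds the
  numerator; no enumeration of trees enters.\<close>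

lemma finite_densities: "finite {density D T | T. dary d T \<and> num_leaves T = n}"
proof (rule finite_subset)
  let ?c = "n choose num_leaves D"
  show "{density D T | T. dary d T \<and> num_leaves T = n} \<subseteq> (\<lambda>c. real c / real ?c) ` {..?c}"
  proof
    fix x assume "x \<in> {density D T | T. dary d T \<and> num_leaves T = n}"
    then obtain T where T: "num_leaves T = n" "x = density D T" by blast
    then show "x \<in> (\<lambda>c. real c / real ?c) ` {..?c}"
      using copies_le_choose[of D T] by (auto simp: density_def)
  qed
qed simp

lemma density_le_max_density: "dary d T \<Longrightarrow> density D T \<le> max_density d D (num_leaves T)"
  unfolding max_density_def by (rule Max_ge[OF finite_densities]) blast

lemma max_density_le:
  assumes "2 \<le> d" "\<And>T. dary d T \<Longrightarrow> num_leaves T = n \<Longrightarrow> density D T \<le> y"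
  shows "max_density d D n \<le> y"
proof -
  have "\<exists>T. dary d T \<and> num_leaves T = n"
  proof (cases "n = 0")
    case True
    then show ?thesis by (intro exI[of _ None]) simp
  next
    case False
    then obtain t where "dary_nonempty d t" "num_leaves (Some t) = n" using ex_dary_tree[OF assms(1), of n] by auto
    then show ?thesis by (intro exI[of _ "Some t"]) simp
  qed
  then show ?thesis unfolding max_density_def using assms(2) finite_densities
    by (intro Max.boundedI) auto
qed

lemma ereal_inducibility:
  assumes "2 \<le> d"
  shows "ereal (inducibility d (Some D)) = limsup (\<lambda>n. ereal (max_density d (Some D) n))"
proof -
  have "0 \<le> max_density d (Some D) n" for n
  proof (cases "n = 0")
    case True
    then show ?thesis
      using density_le_max_density[of d None "Some D"] density_nonneg[of "Some D" None] by simp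
  next
    case False
    then obtain t where "dary_nonempty d t" "num_leaves (Some t) = n" using ex_dary_tree[OF assms, of n] by auto
    then show ?thesis
      using density_le_max_density[of d "Some t" "Some D"] density_nonneg[of "Some D" "Some t"] by simp
  qed
  then have "0 \<le> limsup (\<lambda>n. ereal (max_density d (Some D) n))"
    by (intro le_Limsup) auto
  moreover have "limsup (\<lambda>n. ereal (max_density d (Some D) n)) \<le> ereal 1"
    using max_density_le[OF assms density_le_1] by (intro Limsup_bounded) auto
  ultimately show ?thesis
    by (cases "limsup (\<lambda>n. ereal (max_density d (Some D) n))") (auto simp: inducibility_def)
qed

lemma inducibility_ge:
  assumes "2 \<le> d" "strict_mono (\<lambda>n. num_leaves (T n))" "\<And>n. dary d (T n)"
    and "\<And>n::nat. x n \<le> density D (T n)" "x \<longlonglongrightarrow> l"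
  shows "l \<le> inducibility d D"
proof (cases D)
  case None
  have "x n \<le> 1" for n by (rule order.trans[OF assms(4) density_le_1])
  then have "l \<le> 1" by (intro LIMSEQ_le_const2[OF assms(5)]) simp
  then show ?thesis using None by (simp add: inducibility_def)
next
  case (Some D')
  have "ereal l = limsup (\<lambda>n. ereal (x n))"
    using assms(5) by (intro lim_imp_Limsup[symmetric]) auto
  also have "\<dots> \<le> limsup ((\<lambda>n. ereal (max_density d D n)) \<circ> (\<lambda>n. num_leaves (T n)))"
  proof (intro Limsup_mono always_eventually allI)
    fix n show "ereal (x n) \<le> ((\<lambda>n. ereal (max_density d D n)) \<circ> (\<lambda>n. num_leaves (T n))) n"
      using assms(4)[of n] density_le_max_density[OF assms(3), of D n] by simp
  qed
  also have "\<dots> \<le> limsup (\<lambda>n. ereal (max_density d D n))"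
    by (rule limsup_subseq_mono[OF assms(2)])
  also have "\<dots> = ereal (inducibility d D)"
    unfolding Some by (rule ereal_inducibility[OF assms(1), symmetric])
  finally show ?thesis by simp
qed

lemma inducibility_le:
  assumes "2 \<le> d" "\<And>T. dary d T \<Longrightarrow> density (Some D) T \<le> y (num_leaves T)" "y \<longlonglongrightarrow> l"
  shows "inducibility d (Some D) \<le> l"
proof -
  have "ereal (inducibility d (Some D)) = limsup (\<lambda>n. ereal (max_density d (Some D) n))"
    by (rule ereal_inducibility[OF assms(1)])
  also have "\<dots> \<le> limsup (\<lambda>n. ereal (y n))"
    using assms(1,2) by (intro Limsup_mono always_eventually allI) (auto intro: max_density_le)
  also have "\<dots> = ereal l"
    using assms(3) by (intro lim_imp_Limsup) auto
  finally show ?thesis by simp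
qed

lemma inducibility_nonneg:
  assumes "2 \<le> d" shows "0 \<le> inducibility d D"
proof -
  obtain t where t: "\<And>n. dary_nonempty d (t n)" "\<And>n. num_leaves (Some (t n)) = Suc n"
    using ex_dary_trees[OF assms] by blast
  then show ?thesis
    by (intro inducibility_ge[of d "\<lambda>n. Some (t n)" "\<lambda>_. 0"])
      (use assms in \<open>auto simp: density_nonneg strict_mono_def\<close>)
qed

text \<open>
  Grafting an \<open>m\<close>-leaf tree onto every leaf of \<open>T\<close> multiplies the number of copies by at least
  \<open>m ^ num_leaves D\<close>, so letting \<open>m\<close> tend to infinity gives a bound without error term.
\<close>

lemma copies_le_inducibility:
  assumes "2 \<le> d" "dary d D" "dary d T"
  shows "real (copies D T) \<le> inducibility d D / fact (num_leaves D) * real (num_leaves T) ^ num_leaves D"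
proof (cases T)
  case None
  \<comment> \<open>With both trees empty the right-hand side is 1 by the convention
    \<open>0 ^ 0 = 1\<close>.\<close>
  have "real (copies D T) \<le> inducibility d D / fact (num_leaves D) * real (num_leaves T) ^ num_leaves D"
    if "D = None" using that None by (simp add: inducibility_def)
  moreover have "0 \<le> inducibility d D / fact (num_leaves D) * real (num_leaves T) ^ num_leaves D"
    using inducibility_nonneg[OF assms(1), of D] by simp
  ultimately show ?thesis using None by (cases D) simp_all
next
  case (Some t)
  let ?k = "num_leaves D" and ?n = "num_leaves (Some t)" and ?c = "real (copies D (Some t))"
  have n: "?n > 0" by (rule num_leaves_pos)
  obtain r where r: "\<And>m. dary_nonempty d (r m)" "\<And>m. num_leaves (Some (r m)) = Suc m"
    using ex_dary_trees[OF assms(1)] by blast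
  define N where "N m = Suc m * ?n" for m
  have N: "num_leaves (Some (graft (r m) t)) = N m" for m
    by (simp only: num_leaves_graft r N_def)
  have mono: "strict_mono N"
    using n by (auto simp: strict_mono_def N_def)
  have "?c / real ?n ^ ?k * fact ?k \<le> inducibility d D"
  proof (rule inducibility_ge[where T = "\<lambda>m. Some (graft (r m) t)"])
    show "strict_mono (\<lambda>m. num_leaves (Some (graft (r m) t)))" using mono by (simp add: N)
    show "dary d (Some (graft (r m) t))" for m
      using dary_graft r assms(3) Some by simp
    show "(\<lambda>m. ?c / real ?n ^ ?k * (real (N m) ^ ?k / real (N m choose ?k)))
        \<longlonglongrightarrow> ?c / real ?n ^ ?k * fact ?k"
      using LIMSEQ_subseq_LIMSEQ[OF power_over_choose_tendsto mono, of ?k]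
      by (intro tendsto_mult_left) (simp add: comp_def)
    fix m
    have "?c / real ?n ^ ?k * (real (N m) ^ ?k / real (N m choose ?k))
        = real (Suc m) ^ ?k * ?c / real (N m choose ?k)"
    proof -
      have "real (N m) ^ ?k = real (Suc m) ^ ?k * real ?n ^ ?k"
        by (simp only: N_def of_nat_mult power_mult_distrib)
      then show ?thesis using n by (simp del: of_nat_Suc)
    qed
    also have "\<dots> \<le> density D (Some (graft (r m) t))"
      using copies_graft[of d t D "r m"] assms Some
      by (auto simp: density_def N r intro: divide_right_mono)
    finally show "?c / real ?n ^ ?k * (real (N m) ^ ?k / real (N m choose ?k))
        \<le> density D (Some (graft (r m) t))" .
  qed (rule assms)
  then show ?thesis using n Some by (simp add: field_simps)
qed

subsection \<open>Muirhead's inequality for balanced exponents\<close>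

text \<open>Muirhead's symmetric sum without the normalization \<open>1 / d!\<close>: monomials that
  coincide because of equal exponents are counted repeatedly.\<close>

definition sym_sum :: "nat \<Rightarrow> (nat \<Rightarrow> real) \<Rightarrow> (nat \<Rightarrow> nat) \<Rightarrow> real" where
  "sym_sum d x a = (\<Sum>\<pi> | \<pi> permutes {..<d}. \<Prod>i<d. x (\<pi> i) ^ a i)"

text \<open>The difference of the two sides is
  \<open>(u * v) ^ n * (u - v) * (u ^ c - v ^ c)\<close> with \<open>c = m - n - 1\<close>, and its
  last two factors never have opposite signs.\<close>

lemma two_variable_muirhead:
  fixes u v :: real
  assumes "0 \<le> u" "0 \<le> v" "n < m"
  shows "u ^ (m - 1) * v ^ (n + 1) + v ^ (m - 1) * u ^ (n + 1) \<le> u ^ m * v ^ n + v ^ m * u ^ n"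
proof -
  obtain c where m: "m = Suc (n + c)" using assms(3) less_imp_Suc_add by blast
  have "0 \<le> (u - v) * (u ^ c - v ^ c)"
  proof (cases "u \<le> v")
    case True
    then show ?thesis using power_mono[OF True assms(1), of c] by (intro mult_nonpos_nonpos) auto
  next
    case False
    then show ?thesis using power_mono[of v u c] assms(2) by (intro mult_nonneg_nonneg) auto
  qed
  then have "0 \<le> (u * v) ^ n * ((u - v) * (u ^ c - v ^ c))" using assms by simp
  also have "\<dots> = u ^ m * v ^ n + v ^ m * u ^ n - (u ^ (m - 1) * v ^ (n + 1) + v ^ (m - 1) * u ^ (n + 1))"
    unfolding m by (simp add: algebra_simps power_mult_distrib power_add)
  finally show ?thesis by simp
qed

text \<open>Pairing \<open>\<pi>\<close> with its composition with the transposition of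
  \<open>p\<close> and \<open>q\<close> keeps all factors except those at \<open>p\<close> and
  \<open>q\<close>, which leaves the inequality in two variables.\<close>

lemma sym_sum_transfer:
  assumes x: "\<And>i. i < d \<Longrightarrow> 0 \<le> x i" and pq: "p < d" "q < d" and a: "a q < a p"
  shows "sym_sum d x (a(p := a p - 1, q := a q + 1)) \<le> sym_sum d x a"
proof -
  let ?t = "Transposition.transpose p q" and ?P = "{\<pi>. \<pi> permutes {..<d}}"
  let ?m = "\<lambda>e \<pi>. \<Prod>i<d. x (\<pi> i) ^ e i"
  define r where "r e \<pi> = (\<Prod>i\<in>{..<d} - {p, q}. x (\<pi> i) ^ e i)" for e :: "nat \<Rightarrow> nat" and \<pi> :: "nat \<Rightarrow> nat"
  have ne: "p \<noteq> q" using a by auto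
  have t: "?t permutes {..<d}" by (rule permutes_swap_id) (use pq in auto)
  have m: "?m e \<pi> = x (\<pi> p) ^ e p * x (\<pi> q) ^ e q * r e \<pi>" for e \<pi>
  proof -
    have "{..<d} = insert p (insert q ({..<d} - {p, q}))" using pq by auto
    then have "?m e \<pi> = (\<Prod>i\<in>insert p (insert q ({..<d} - {p, q})). x (\<pi> i) ^ e i)" by simp
    then show ?thesis using ne by (simp add: r_def)
  qed
  have double: "2 * sym_sum d x e = (\<Sum>\<pi>\<in>?P.
      (x (\<pi> p) ^ e p * x (\<pi> q) ^ e q + x (\<pi> q) ^ e p * x (\<pi> p) ^ e q) * r e \<pi>)" for e
  proof -
    have "2 * sym_sum d x e = (\<Sum>\<pi>\<in>?P. ?m e \<pi>) + (\<Sum>\<pi>\<in>?P. ?m e (\<pi> \<circ> ?t))"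
      using sum_permutations_compose_right[OF t, of "?m e"] by (simp add: sym_sum_def)
    also have "\<dots> = (\<Sum>\<pi>\<in>?P. ?m e \<pi> + ?m e (\<pi> \<circ> ?t))"
      by (rule sum.distrib[symmetric])
    also have "\<dots> = (\<Sum>\<pi>\<in>?P. (x (\<pi> p) ^ e p * x (\<pi> q) ^ e q + x (\<pi> q) ^ e p * x (\<pi> p) ^ e q) * r e \<pi>)"
    proof (intro sum.cong refl)
      fix \<pi>
      have r: "r e (\<pi> \<circ> ?t) = r e \<pi>"
        unfolding r_def by (intro prod.cong refl) (auto simp: transpose_apply_other)
      show "?m e \<pi> + ?m e (\<pi> \<circ> ?t) =
          (x (\<pi> p) ^ e p * x (\<pi> q) ^ e q + x (\<pi> q) ^ e p * x (\<pi> p) ^ e q) * r e \<pi>"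
        unfolding m r by (simp add: algebra_simps)
    qed
    finally show ?thesis .
  qed
  let ?a' = "a(p := a p - 1, q := a q + 1)"
  have "2 * sym_sum d x ?a' \<le> 2 * sym_sum d x a"
    unfolding double
  proof (intro sum_mono)
    fix \<pi> assume "\<pi> \<in> ?P"
    then have \<pi>: "\<pi> i < d" if "i < d" for i using permutes_in_image[of \<pi> "{..<d}" i] that by simp
    have r: "r ?a' \<pi> = r a \<pi>"
      unfolding r_def by (intro prod.cong) auto
    have "0 \<le> r a \<pi>" unfolding r_def using x \<pi> by (intro prod_nonneg) auto
    moreover have "x (\<pi> p) ^ (a p - 1) * x (\<pi> q) ^ (a q + 1) + x (\<pi> q) ^ (a p - 1) * x (\<pi> p) ^ (a q + 1)
        \<le> x (\<pi> p) ^ a p * x (\<pi> q) ^ a q + x (\<pi> q) ^ a p * x (\<pi> p) ^ a q"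
      using x \<pi> pq a by (intro two_variable_muirhead) auto
    ultimately show "(x (\<pi> p) ^ ?a' p * x (\<pi> q) ^ ?a' q + x (\<pi> q) ^ ?a' p * x (\<pi> p) ^ ?a' q) * r ?a' \<pi>
        \<le> (x (\<pi> p) ^ a p * x (\<pi> q) ^ a q + x (\<pi> q) ^ a p * x (\<pi> p) ^ a q) * r a \<pi>"
      unfolding r using ne by (intro mult_right_mono) auto
  qed
  then show ?thesis by simp
qed

text \<open>While \<open>a\<close> differs from \<open>b\<close>, equal totals yield a
  \<open>p\<close> with too large and a \<open>q\<close> with too small an exponent; moving one unit
  from \<open>p\<close> to \<open>q\<close> does not increase the symmetric sum. Balance guarantees
  that such a move is always of the kind covered by \<open>sym_sum_transfer\<close>.\<close>

lemma muirhead_balanced: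
  assumes x: "\<And>i. i < d \<Longrightarrow> 0 \<le> x i"
    and b: "\<And>i j. i < d \<Longrightarrow> j < d \<Longrightarrow> b i \<le> b j + 1"
    and "(\<Sum>i<d. a i) = (\<Sum>i<d. b i)"
  shows "sym_sum d x b \<le> sym_sum d x a"
  using assms(3)
\<comment> \<open>Truncated subtraction makes this the total excess of \<open>a\<close> over
  \<open>b\<close>, which each move lowers by one.\<close>
proof (induction "\<Sum>i<d. a i - b i" arbitrary: a rule: less_induct)
  case (less a)
  show ?case
  proof (cases "\<forall>i<d. a i = b i")
    case True
    then have "sym_sum d x b = sym_sum d x a"
      unfolding sym_sum_def by (intro sum.cong prod.cong) auto
    then show ?thesis by simp
  next
    case False
    have "\<exists>p<d. b p < a p"
    proof (rule ccontr)
      assume "\<not> (\<exists>p<d. b p < a p)"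
      then have "(\<Sum>i<d. a i) < (\<Sum>i<d. b i)"
        using False by (intro sum_strict_mono_ex1) force+
      then show False using less.prems by simp
    qed
    then obtain p where p: "p < d" "b p < a p" by blast
    have "\<exists>q<d. a q < b q"
    proof (rule ccontr)
      assume "\<not> (\<exists>q<d. a q < b q)"
      then have "(\<Sum>i<d. b i) < (\<Sum>i<d. a i)"
        using False by (intro sum_strict_mono_ex1) force+
      then show False using less.prems by simp
    qed
    then obtain q where q: "q < d" "a q < b q" by blast
    \<comment> \<open>Here balance enters: \<open>a q < b q \<le> b p + 1 \<le> a p\<close>.\<close>
    have apq: "a q < a p" using b[OF q(1) p(1)] p q by simp
    have ne: "p \<noteq> q" using p q by auto
    let ?a' = "a(p := a p - 1, q := a q + 1)"
    have split: "(\<Sum>i<d. f i) = f p + (f q + (\<Sum>i\<in>{..<d} - {p, q}. f i))" for f :: "nat \<Rightarrow> nat"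
    proof -
      have "{..<d} = insert p (insert q ({..<d} - {p, q}))" using p q by auto
      then have "(\<Sum>i<d. f i) = (\<Sum>i\<in>insert p (insert q ({..<d} - {p, q})). f i)" by simp
      then show ?thesis using ne by simp
    qed
    have "(\<Sum>i<d. ?a' i) = (\<Sum>i<d. a i)"
      unfolding split using ne p by simp
    moreover have "(\<Sum>i<d. ?a' i - b i) < (\<Sum>i<d. a i - b i)"
      unfolding split using ne p q by simp
    ultimately have "sym_sum d x b \<le> sym_sum d x ?a'"
      using less.hyps[of ?a'] less.prems by simp
    also have "\<dots> \<le> sym_sum d x a"
      by (rule sym_sum_transfer[OF x p(1) q(1) apq])
    finally show ?thesis .
  qed
qed

text \<open>
  Expand the power of the sum over maps \<open>f\<close> from \<open>{..<k}\<close> to \<open>{..<d}\<close>: the constant maps give the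
  pure powers, and after symmetrization Muirhead's inequality applies to each of the other
  \<open>d ^ k - d\<close> maps.
\<close>

lemma balanced_sym_sum_bound:
  fixes x :: "nat \<Rightarrow> real"
  assumes x: "\<And>i. i < d \<Longrightarrow> 0 \<le> x i"
    and b: "\<And>i j. i < d \<Longrightarrow> j < d \<Longrightarrow> b i \<le> b j + 1"
    and k: "(\<Sum>i<d. b i) = k" "0 < k"
  shows "(real d ^ k - real d) * sym_sum d x b \<le> fact d * ((\<Sum>i<d. x i) ^ k - (\<Sum>i<d. x i ^ k))"
proof -
  define F where "F = {..<k} \<rightarrow>\<^sub>E {..<d}"
  define cmap where "cmap j = restrict (\<lambda>_. j) {..<k}" for j :: nat
  let ?C = "cmap ` {..<d}" and ?P = "{\<pi>. \<pi> permutes {..<d}}"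
  define G where "G f = (\<Sum>\<pi>\<in>?P. \<Prod>i<k. x (\<pi> (f i)))" for f :: "nat \<Rightarrow> nat"
  have finF: "finite F" unfolding F_def by (intro finite_PiE) auto
  have cardP: "card ?P = fact d" by (rule card_permutations) auto
  have reindex: "(\<Sum>j<d. f (\<pi> j)) = (\<Sum>j<d. f j)" if "\<pi> \<in> ?P" for \<pi> and f :: "nat \<Rightarrow> real"
    by (rule sum.reindex_bij_betw[OF permutes_imp_bij]) (use that in simp)
  have cmap: "cmap j i = j" if "i < k" for i j using that by (simp add: cmap_def)
  \<comment> \<open>Different constant maps differ at 0, which lies in their domain because
    \<open>k\<close> is positive.\<close>
  have inj: "inj_on cmap {..<d}" using cmap[OF k(2)] by (metis inj_onI)
  have CF: "?C \<subseteq> F" unfolding F_def cmap_def by (intro image_subsetI restrict_PiE_iff[THEN iffD2]) simp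
  have all: "(\<Sum>f\<in>F. G f) = fact d * (\<Sum>i<d. x i) ^ k"
  proof -
    have "(\<Sum>f\<in>F. G f) = (\<Sum>\<pi>\<in>?P. \<Sum>f\<in>F. \<Prod>i<k. x (\<pi> (f i)))"
      unfolding G_def by (rule sum.swap)
    also have "\<dots> = (\<Sum>\<pi>\<in>?P. \<Prod>i<k. \<Sum>j<d. x (\<pi> j))"
      unfolding F_def by (intro sum.cong refl prod_sum_PiE[symmetric]) auto
    also have "\<dots> = (\<Sum>\<pi>\<in>?P. (\<Sum>i<d. x i) ^ k)"
      by (intro sum.cong refl) (simp add: reindex)
    finally show ?thesis by (simp add: cardP)
  qed
  have pure: "(\<Sum>f\<in>?C. G f) = fact d * (\<Sum>i<d. x i ^ k)"
  proof -
    have "(\<Sum>f\<in>?C. G f) = (\<Sum>j<d. G (cmap j))"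
      by (rule sum.reindex_cong[OF inj refl refl])
    also have "\<dots> = (\<Sum>j<d. \<Sum>\<pi>\<in>?P. x (\<pi> j) ^ k)"
      unfolding G_def by (intro sum.cong refl) (simp add: cmap)
    also have "\<dots> = (\<Sum>\<pi>\<in>?P. \<Sum>j<d. x (\<pi> j) ^ k)"
      by (rule sum.swap)
    also have "\<dots> = (\<Sum>\<pi>\<in>?P. \<Sum>i<d. x i ^ k)"
      by (intro sum.cong refl reindex[of _ "\<lambda>i. x i ^ k"])
    finally show ?thesis by (simp add: cardP)
  qed
  have "sym_sum d x b \<le> G f" if "f \<in> F" for f
  proof -
    \<comment> \<open>The fibre sizes of \<open>f\<close>: collecting equal factors turns
      \<open>G f\<close> into the symmetric sum with exponents \<open>a\<close>, whose total is
      \<open>k\<close> as for \<open>b\<close>.\<close>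
    define a where "a j = card {i \<in> {..<k}. f i = j}" for j
    have f: "f ` {..<k} \<subseteq> {..<d}" using that by (auto simp: F_def)
    have "(\<Prod>i<k. x (\<pi> (f i))) = (\<Prod>j<d. x (\<pi> j) ^ a j)" for \<pi>
    proof -
      have "(\<Prod>i<k. x (\<pi> (f i))) = (\<Prod>j<d. \<Prod>i\<in>{i \<in> {..<k}. f i = j}. x (\<pi> (f i)))"
        by (rule prod.group[symmetric]) (use f in auto)
      also have "\<dots> = (\<Prod>j<d. x (\<pi> j) ^ a j)"
        unfolding a_def by (intro prod.cong refl) (simp flip: prod_constant)
      finally show ?thesis .
    qed
    then have "G f = sym_sum d x a" by (simp add: G_def sym_sum_def)
    moreover have "(\<Sum>j<d. a j) = k"
      using sum.group[of "{..<k}" "{..<d}" f "\<lambda>_. 1::nat"] f by (simp add: a_def)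
    ultimately show ?thesis using muirhead_balanced[OF x b] k by simp
  qed
  then have "(\<Sum>f\<in>F - ?C. sym_sum d x b) \<le> (\<Sum>f\<in>F - ?C. G f)" by (intro sum_mono) auto
  also have "\<dots> = (\<Sum>f\<in>F. G f) - (\<Sum>f\<in>?C. G f)"
    by (rule sum_diff[OF finF CF])
  also have "(\<Sum>f\<in>F - ?C. sym_sum d x b) = (real d ^ k - real d) * sym_sum d x b"
  proof -
    have "card F = d ^ k" unfolding F_def by (simp add: card_PiE)
    moreover have "card ?C = d" using card_image[OF inj] by simp
    moreover have "card ?C \<le> card F" by (rule card_mono[OF finF CF])
    ultimately show ?thesis
      using finF CF by (simp add: card_Diff_subset finite_subset of_nat_diff)
  qed
  finally show ?thesis unfolding all pure by (simp add: algebra_simps)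
qed

subsection \<open>The upper bound\<close>

lemma power_minus_base_pos:
  assumes "2 \<le> d" "2 \<le> k" shows "0 < real d ^ k - real d"
  using power_strict_increasing[of 1 k "real d"] assms by simp

text \<open>The constant is dictated by the induction: \<open>Q * (d ^ k - d)\<close> has to be
  \<open>|M(D)|\<close> times the product of the \<open>c i\<close>. Then the mixed terms of
  \<open>(\<Sum>j<d. x j) ^ k\<close> pay for the copies spread over several branches, and the pure
  powers for those inside one branch.\<close>

lemma balanced_copies_bound:
  assumes d: "2 \<le> d" and D: "dary_nonempty d (Node ds)" "2 \<le> length ds" "length ds \<le> d"
    and bal: "balanced d (Node ds)" and "dary d T"
  defines "k \<equiv> num_leaves (Some (Node ds))"
  shows "real (copies (Some (Node ds)) T) \<le> real (card (perm_reps d (Node ds))) *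
    (\<Prod>i<d. inducibility d (branch d (Node ds) i) / fact (num_leaves (branch d (Node ds) i)))
    / (real d ^ k - real d) * real (num_leaves T) ^ k"
proof (cases T)
  case None
  then show ?thesis using num_leaves_pos[of "Node ds"] by (simp add: k_def zero_power)
next
  case (Some t)
  let ?D = "branch d (Node ds)" and ?M = "real (card (perm_reps d (Node ds)))"
  define b where "b i = num_leaves (?D i)" for i
  define c where "c i = inducibility d (?D i) / fact (b i)" for i
  define Q where "Q = ?M * (\<Prod>i<d. c i) / (real d ^ k - real d)"
  have ds: "ds \<noteq> []" using D(2) by auto
  have k2: "2 \<le> k" using num_leaves_Node_ge[of ds] D(2) by (simp add: k_def)
  have pos: "0 < real d ^ k - real d" by (rule power_minus_base_pos[OF d k2])
  have c0: "0 \<le> c i" for i using inducibility_nonneg[OF d] by (simp add: c_def)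
  have Q0: "0 \<le> Q" using c0 pos by (auto simp: Q_def intro!: prod_nonneg divide_nonneg_pos mult_nonneg_nonneg)
  have bsum: "(\<Sum>i<d. b i) = k"
    unfolding k_def b_def by (rule num_leaves_branches[OF ds D(3), symmetric])
  have bbal: "b i \<le> b j + 1" if "i < d" "j < d" for i j
    using bal that unfolding balanced_def b_def by fastforce
  have "dary_nonempty d t" using assms Some by simp
  then have "real (copies (Some (Node ds)) (Some t)) \<le> Q * real (num_leaves (Some t)) ^ k"
  proof (induction t rule: dary_nonempty_induct)
    case leaf
    have "copies (Some (Node ds)) (Some (Node [])) = 0"
      using k2 by (intro copies_too_large) (simp add: k_def)
    then show ?case using Q0 by simp
  next
    case (Node ts)
    let ?T = "branch d (Node ts)"
    define x where "x j = real (num_leaves (?T j))" for j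
    have ts: "ts \<noteq> []" using Node.hyps(1) by auto
    have IH: "real (copies (Some (Node ds)) (?T j)) \<le> Q * x j ^ k" if "j < d" for j
    proof (cases "j < length ts")
      case True
      then show ?thesis using Node.IH[of "ts ! j"] Node.hyps that by (simp add: branch_Node x_def)
    next
      case False
      then show ?thesis using Node.hyps(2) that k2 by (simp add: branch_Node x_def zero_power)
    qed
    have sumx: "(\<Sum>j<d. x j) = real (num_leaves (Some (Node ts)))"
      unfolding num_leaves_branches[OF ts Node.hyps(2)] x_def by simp
    have "real (copies (Some (Node ds)) (Some (Node ts))) \<le> (\<Sum>j<d. Q * x j ^ k) +
        ?M / fact d * (\<Sum>\<pi> | \<pi> permutes {..<d}. \<Prod>i<d. c i * x (\<pi> i) ^ b i)"
      unfolding copies_recurrence[OF ts Node.hyps(2) D(2,3)]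
    proof (intro add_mono sum_mono mult_left_mono prod_mono conjI)
      fix \<pi> i assume "\<pi> \<in> {\<pi>. \<pi> permutes {..<d}}" "i \<in> {..<d}"
      then have i: "i < d" "\<pi> i < d" using permutes_in_image[of \<pi> "{..<d}" i] by simp_all
      show "real (copies (?D i) (?T (\<pi> i))) \<le> c i * x (\<pi> i) ^ b i"
        unfolding c_def x_def b_def
        by (rule copies_le_inducibility[OF d dary_branch[OF D(1) i(1)] dary_branch[OF Node.hyps(3) i(2)]])
    qed (use IH in auto)
    also have "(\<Sum>\<pi> | \<pi> permutes {..<d}. \<Prod>i<d. c i * x (\<pi> i) ^ b i) = (\<Prod>i<d. c i) * sym_sum d x b"
      by (simp add: sym_sum_def prod.distrib sum_distrib_left)
    \<comment> \<open>By the choice of \<open>Q\<close> the factor \<open>d ^ k - d\<close> appears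
      in front of the symmetric sum. Bounding this product brings in the pure powers with a minus
      sign, and they cancel those contributed by the branches.\<close>
    also have "(\<Sum>j<d. Q * x j ^ k) + ?M / fact d * ((\<Prod>i<d. c i) * sym_sum d x b)
        = Q * (\<Sum>j<d. x j ^ k) + Q / fact d * ((real d ^ k - real d) * sym_sum d x b)"
      using pos by (simp add: Q_def sum_distrib_left)
    also have "\<dots> \<le> Q * (\<Sum>j<d. x j ^ k) + Q / fact d * (fact d * ((\<Sum>i<d. x i) ^ k - (\<Sum>i<d. x i ^ k)))"
      using Q0 bbal bsum k2
      by (intro add_left_mono mult_left_mono balanced_sym_sum_bound) (auto simp: x_def)
    also have "\<dots> = Q * (\<Sum>i<d. x i) ^ k" by (simp add: algebra_simps)
    finally show ?case unfolding sumx .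
  qed
  then show ?thesis by (simp add: Some Q_def c_def b_def)
qed

lemma balanced_inducibility_bound:
  assumes d: "2 \<le> d" and D: "dary_nonempty d (Node ds)" "2 \<le> length ds" "length ds \<le> d"
    and bal: "balanced d (Node ds)"
  defines "k \<equiv> num_leaves (Some (Node ds))"
  shows "inducibility d (Some (Node ds)) \<le> fact k * (real (card (perm_reps d (Node ds))) *
    (\<Prod>i<d. inducibility d (branch d (Node ds) i) / fact (num_leaves (branch d (Node ds) i)))
    / (real d ^ k - real d))" (is "_ \<le> fact k * ?Q")
proof (rule inducibility_le[OF d])
  show "(\<lambda>n. real n ^ k / real (n choose k) * ?Q) \<longlonglongrightarrow> fact k * ?Q"
    by (intro tendsto_mult_right power_over_choose_tendsto)
  fix T assume "dary d T"
  then have "real (copies (Some (Node ds)) T) \<le> ?Q * real (num_leaves T) ^ k"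
    unfolding k_def by (rule balanced_copies_bound[OF d D bal])
  then have "density (Some (Node ds)) T \<le> ?Q * real (num_leaves T) ^ k / real (num_leaves T choose k)"
    unfolding density_def k_def[symmetric] by (rule divide_right_mono) simp
  then show "density (Some (Node ds)) T \<le> real (num_leaves T) ^ k / real (num_leaves T choose k) * ?Q"
    by (simp only: times_divide_eq_left mult.commute)
qed

subsection \<open>Densities in the trees \<open>H\<close>\<close>

declare H_tree.simps [simp del]

abbreviation H_index :: "nat \<Rightarrow> nat \<Rightarrow> nat \<Rightarrow> nat" where
  "H_index d j m \<equiv> if j < d - m mod d then m div d else Suc (m div d)"

lemma branch_H_tree: "j < d \<Longrightarrow> branch d (H_tree d (Suc m)) j = Some (H_tree d (H_index d j m))"
  by (simp add: H_tree.simps branch_Node)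

lemma dary_H_tree: "2 \<le> d \<Longrightarrow> dary_nonempty d (H_tree d n)"
proof (induction d n rule: H_tree.induct)
  case (2 d m)
  then show ?case by (auto simp: H_tree.simps(2))
qed (simp add: H_tree.simps)

text \<open>The index of an \<open>H\<close> tree is its number of inner vertices; besides the root,
  \<open>H_tree d (Suc m)\<close> has \<open>m\<close> of them, distributed over the
  branches.\<close>

lemma sum_H_index: "0 < d \<Longrightarrow> (\<Sum>j<d. H_index d j m) = m"
proof -
  assume d: "0 < d"
  have "(\<Sum>j<d. H_index d j m) = (\<Sum>j<d. m div d + (if j < d - m mod d then 0 else 1))"
    by (intro sum.cong) auto
  also have "\<dots> = d * (m div d) + (\<Sum>j<d. if j < d - m mod d then 0 else 1)"
    by (simp add: sum.distrib)
  also have "(\<Sum>j<d. if j < d - m mod d then 0 else 1) = (\<Sum>j\<in>{d - m mod d..<d}. 1::nat)"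
    by (intro sum.mono_neutral_cong_right) auto
  finally show ?thesis using d by simp
qed

lemma num_leaves_H_tree:
  assumes "2 \<le> d" shows "num_leaves (Some (H_tree d n)) = (d - 1) * n + 1"
  using assms
proof (induction d n rule: H_tree.induct)
  case (2 d m)
  let ?T = "H_tree d (Suc m)"
  obtain ts where ts: "?T = Node ts" by (cases ?T)
  then have "length ts = d" by (auto simp: H_tree.simps(2))
  then have "num_leaves (Some ?T) = (\<Sum>j<d. num_leaves (branch d ?T j))"
    unfolding ts using 2 by (intro num_leaves_branches) auto
  also have "\<dots> = (\<Sum>j<d. (d - 1) * H_index d j m + 1)"
    using 2 by (intro sum.cong refl) (simp add: branch_H_tree del: One_nat_def)
  also have "\<dots> = (d - 1) * (\<Sum>j<d. H_index d j m) + d"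
    by (simp only: sum.distrib sum_distrib_left) simp
  also have "\<dots> = (d - 1) * Suc m + 1"
    using 2 by (subst sum_H_index) auto
  finally show ?case .
qed (simp add: H_tree.simps)

lemma H_index_tendsto: "0 < d \<Longrightarrow> filterlim (H_index d j) at_top sequentially"
proof -
  assume d: "0 < d"
  show ?thesis unfolding filterlim_at_top
  proof
    fix Z
    show "eventually (\<lambda>m. Z \<le> H_index d j m) sequentially"
      using eventually_ge_at_top[of "Z * d"]
    proof eventually_elim
      case (elim m)
      then have "Z \<le> m div d" using d by (simp add: less_eq_div_iff_mult_less_eq)
      then show ?case by simp
    qed
  qed
qed

text \<open>The index of a branch differs from \<open>m / d\<close> by at most 1, so its share of
  the leaves differs from \<open>1 / d\<close> by \<open>O(1 / m)\<close>.\<close>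

lemma H_index_ratio_tendsto:
  assumes "2 \<le> d"
  shows "(\<lambda>m. real ((d - 1) * H_index d j m + 1) / real ((d - 1) * Suc m + 1)) \<longlonglongrightarrow> 1 / real d"
proof (rule LIM_zero_cancel, rule tendsto_rabs_zero_cancel)
  let ?r = "\<lambda>m. real ((d - 1) * H_index d j m + 1) / real ((d - 1) * Suc m + 1)"
  show "(\<lambda>m. \<bar>?r m - 1 / real d\<bar>) \<longlonglongrightarrow> 0"
  proof (rule tendsto_sandwich[OF _ _ tendsto_const])
    show "(\<lambda>m. real d * inverse (real (Suc m))) \<longlonglongrightarrow> 0"
      using tendsto_mult_left[OF LIMSEQ_inverse_real_of_nat, of "real d"] by simp
    show "eventually (\<lambda>m. \<bar>?r m - 1 / real d\<bar> \<le> real d * inverse (real (Suc m))) sequentially"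
    proof (intro always_eventually allI)
      fix m
      define h where "h = real (H_index d j m)"
      define L where "L = (real d - 1) * (1 + real m) + 1"
      have m: "real m = real d * real (m div d) + real (m mod d)"
        by (metis mult_div_mod_eq of_nat_add of_nat_mult)
      have mod: "real (m mod d) \<le> real d" using assms by (simp add: less_imp_le)
      have dh: "\<bar>real d * h - real m\<bar> \<le> real d"
        using mod unfolding h_def by (auto simp: m algebra_simps)
      have L: "1 + real m \<le> L"
      proof -
        have "1 * (1 + real m) \<le> (real d - 1) * (1 + real m)"
          using assms by (intro mult_right_mono) auto
        then show ?thesis unfolding L_def mult_1 by (rule add_increasing2[OF zero_le_one])
      qed
      then have Lpos: "0 < L" by linarith
      have r: "?r m = ((real d - 1) * h + 1) / L"
      proof -
        have "real ((d - 1) * n + 1) = (real d - 1) * real n + 1" for n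
          using assms by (simp add: of_nat_diff)
        then show ?thesis by (simp only: h_def L_def of_nat_Suc)
      qed
      \<comment> \<open>Over the common denominator the constants cancel, since
        \<open>L = (d - 1) * m + d\<close>.\<close>
      have "?r m - 1 / real d = (real d - 1) * (real d * h - real m) / (real d * L)"
        using assms Lpos unfolding r by (simp add: field_simps) (simp add: L_def algebra_simps)
      then have "\<bar>?r m - 1 / real d\<bar> = (real d - 1) * \<bar>real d * h - real m\<bar> / (real d * L)"
        using assms Lpos by (simp add: abs_mult)
      also have "\<dots> \<le> real d * real d / (real d * L)"
        using assms Lpos dh by (intro divide_right_mono mult_mono) auto
      also have "\<dots> = real d / L" using assms by simp
      also have "\<dots> \<le> real d / (1 + real m)"
        using L Lpos by (intro divide_left_mono) auto
      finally show "\<bar>?r m - 1 / real d\<bar> \<le> real d * inverse (real (Suc m))"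
        by (simp add: field_simps)
    qed
  qed simp
qed

text \<open>For \<open>l = limsup |e n|\<close> the recursion gives
  \<open>l \<le> \<rho> * l\<close>, hence \<open>l = 0\<close>. The proof does this in finite
  steps: one pass through the recursion improves the eventual bound \<open>B * q ^ i + r / 2\<close>
  to the one for \<open>i + 1\<close>.\<close>

lemma contraction_tendsto_zero:
  fixes e \<delta> :: "nat \<Rightarrow> real" and w :: "'j \<Rightarrow> nat \<Rightarrow> real"
  assumes bound: "\<And>n. \<bar>e n\<bar> \<le> B"
    and rec: "\<And>m. \<bar>e (Suc m)\<bar> \<le> (\<Sum>j\<in>J. w j m * \<bar>e (h j m)\<bar>) + \<delta> m"
    and J: "finite J" and w: "\<And>j m. j \<in> J \<Longrightarrow> 0 \<le> w j m"
    and h: "\<And>j. j \<in> J \<Longrightarrow> filterlim (h j) at_top sequentially"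
    and W: "(\<lambda>m. \<Sum>j\<in>J. w j m) \<longlonglongrightarrow> \<rho>" "\<rho> < 1" and \<delta>: "\<delta> \<longlonglongrightarrow> 0"
  shows "e \<longlonglongrightarrow> 0"
proof (rule tendstoI)
  fix r :: real assume r: "0 < r"
  \<comment> \<open>Strictly above \<open>\<rho>\<close>, \<open>q\<close> bounds the sum of the
    weights for all large \<open>m\<close>; \<open>max 0\<close> makes it positive, so that its
    powers decrease to 0.\<close>
  obtain q where q: "max 0 \<rho> < q" "q < 1" using dense[of "max 0 \<rho>" 1] W(2) by auto
  \<comment> \<open>Chosen such that \<open>q * (r / 2) + \<epsilon> = r / 2\<close>: the summand
    \<open>r / 2\<close> reproduces itself.\<close>
  define \<epsilon> where "\<epsilon> = r / 2 * (1 - q)"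
  have \<epsilon>: "0 < \<epsilon>" using r q by (simp_all add: \<epsilon>_def)
  have B: "0 \<le> B" using bound[of 0] by linarith
  have step: "eventually (\<lambda>n. \<bar>e n\<bar> \<le> B * q ^ i + r / 2) sequentially" for i
  proof (induction i)
    case 0
    have "\<bar>e n\<bar> \<le> B + r / 2" for n using bound[of n] r by linarith
    then show ?case by simp
  next
    case (Suc i)
    let ?K = "B * q ^ i + r / 2"
    have K: "0 \<le> ?K" using B q r by simp
    have "eventually (\<lambda>m. \<forall>j\<in>J. \<bar>e (h j m)\<bar> \<le> ?K) sequentially"
      by (intro eventually_ball_finite J ballI) (rule eventually_compose_filterlim[OF Suc h])
    moreover have "eventually (\<lambda>m. (\<Sum>j\<in>J. w j m) < q) sequentially"
      by (rule order_tendstoD(2)[OF W(1)]) (use q in simp)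
    moreover have "eventually (\<lambda>m. \<delta> m < \<epsilon>) sequentially"
      by (rule order_tendstoD(2)[OF \<delta> \<epsilon>])
    ultimately have "eventually (\<lambda>m. \<bar>e (Suc m)\<bar> \<le> B * q ^ Suc i + r / 2) sequentially"
    proof eventually_elim
      case (elim m)
      have "\<bar>e (Suc m)\<bar> \<le> (\<Sum>j\<in>J. w j m * \<bar>e (h j m)\<bar>) + \<delta> m" by (rule rec)
      also have "\<dots> \<le> (\<Sum>j\<in>J. w j m * ?K) + \<epsilon>"
        using elim w by (intro add_mono sum_mono mult_left_mono) auto
      also have "\<dots> = (\<Sum>j\<in>J. w j m) * ?K + \<epsilon>" by (simp add: sum_distrib_right)
      also have "\<dots> \<le> q * ?K + \<epsilon>"
        using elim K by (intro add_right_mono mult_right_mono) auto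
      also have "\<dots> = B * q ^ Suc i + r / 2" by (simp add: \<epsilon>_def field_simps)
      finally show ?case .
    qed
    then show ?case by (rule eventually_sequentially_Suc[THEN iffD1])
  qed
  have "(\<lambda>i. B * q ^ i) \<longlonglongrightarrow> B * 0"
    using q by (intro tendsto_mult_left LIMSEQ_realpow_zero) auto
  then have "eventually (\<lambda>i. B * q ^ i < r / 2) sequentially"
    by (rule order_tendstoD(2)) (use r in simp)
  then obtain i where i: "B * q ^ i < r / 2" by (auto simp: eventually_sequentially)
  show "eventually (\<lambda>n. dist (e n) 0 < r) sequentially"
    using step[of i] by eventually_elim (use i in \<open>simp add: dist_real_def\<close>)
qed

text \<open>A power replaces the binomial coefficient of \<open>density\<close>: powers are
  multiplicative over the branches, so the recurrence becomes one in the shares of leaves. In the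
  limit this costs the factor \<open>fact (num_leaves D)\<close>.\<close>

definition scaled_copies :: "nat \<Rightarrow> rtree option \<Rightarrow> nat \<Rightarrow> real" where
  "scaled_copies d D n = real (copies D (Some (H_tree d n))) / real ((d - 1) * n + 1) ^ num_leaves D"

lemma real_affine_pos: "0 < real (a * n + 1)"
  by (simp only: of_nat_0_less_iff)

lemma scaled_copies_bounds:
  assumes "2 \<le> d" shows "0 \<le> scaled_copies d D n" "scaled_copies d D n \<le> 1"
proof -
  let ?N = "(d - 1) * n + 1"
  have "copies D (Some (H_tree d n)) \<le> ?N choose num_leaves D"
    using copies_le_choose[of D "Some (H_tree d n)"] num_leaves_H_tree[OF assms] by simp
  also have "\<dots> \<le> ?N ^ num_leaves D"
    by (cases "num_leaves D \<le> ?N") (auto simp: binomial_le_pow binomial_eq_0)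
  finally have "real (copies D (Some (H_tree d n))) \<le> real ?N ^ num_leaves D"
    by (metis of_nat_le_iff of_nat_power)
  then show "scaled_copies d D n \<le> 1"
    unfolding scaled_copies_def by (rule divide_le_eq_1_pos[OF zero_less_power[OF real_affine_pos], THEN iffD2])
qed (simp add: scaled_copies_def)

lemma copies_H_tree_eq:
  "real (copies D (Some (H_tree d n))) = real ((d - 1) * n + 1) ^ num_leaves D * scaled_copies d D n"
  using real_affine_pos[of "d - 1" n] by (simp add: scaled_copies_def del: of_nat_add of_nat_mult of_nat_Suc)

text \<open>After division by the \<open>k\<close>-th power of the leaf number, each branch of the
  \<open>H\<close> tree has weight tending to \<open>(1 / d) ^ k\<close>. The \<open>d\<close>
  weights sum to less than 1 in the limit because \<open>k \<ge> 2\<close>, so the recurrence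
  contracts towards the solution of the limiting equation.\<close>

lemma scaled_copies_tendsto:
  assumes d: "2 \<le> d" and ds: "2 \<le> length ds" "length ds \<le> d"
    and lim: "\<And>i. i < d \<Longrightarrow> scaled_copies d (branch d (Node ds) i) \<longlonglongrightarrow> \<alpha> i"
  defines "k \<equiv> num_leaves (Some (Node ds))"
  shows "scaled_copies d (Some (Node ds)) \<longlonglongrightarrow>
    real (card (perm_reps d (Node ds))) * (\<Prod>i<d. \<alpha> i) / (real d ^ k - real d)"
proof -
  let ?D = "branch d (Node ds)" and ?M = "real (card (perm_reps d (Node ds)))"
  let ?s = "scaled_copies d (Some (Node ds))" and ?P = "{\<pi>. \<pi> permutes {..<d}}"
  define b where "b i = num_leaves (?D i)" for i
  define L where "L n = real ((d - 1) * n + 1)" for n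
  \<comment> \<open>The share of branch \<open>j\<close> in the leaves of
    \<open>H_tree d (Suc m)\<close>.\<close>
  define R where "R j m = L (H_index d j m) / L (Suc m)" for j m
  define second where "second m = ?M / fact d *
    (\<Sum>\<pi>\<in>?P. \<Prod>i<d. R (\<pi> i) m ^ b i * scaled_copies d (?D i) (H_index d (\<pi> i) m))" for m
  define a where "a = ?M * (\<Prod>i<d. \<alpha> i) / (real d ^ k - real d)"
  have d0: "0 < d" using d by simp
  have Lpos: "0 < L n" for n unfolding L_def by (rule real_affine_pos)
  have R0: "0 \<le> R j m" for j m using Lpos by (simp add: R_def less_imp_le)
  have k2: "2 \<le> k" using num_leaves_Node_ge[of ds] ds(1) by (simp add: k_def)
  have bsum: "(\<Sum>i<d. b i) = k"
    unfolding k_def b_def using ds by (intro num_leaves_branches[symmetric]) auto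
  have R: "R j \<longlonglongrightarrow> 1 / real d" for j
    unfolding R_def L_def by (rule H_index_ratio_tendsto[OF d])
  have rec: "?s (Suc m) = (\<Sum>j<d. R j m ^ k * ?s (H_index d j m)) + second m" for m
  proof -
    obtain ts where ts: "H_tree d (Suc m) = Node ts" by (cases "H_tree d (Suc m)")
    then have "length ts = d" by (auto simp: H_tree.simps(2))
    then have ts': "ts \<noteq> []" "length ts \<le> d" using d by auto
    have first: "real (copies (Some (Node ds)) (branch d (Node ts) j)) = L (H_index d j m) ^ k * ?s (H_index d j m)"
      if "j < d" for j
      using copies_H_tree_eq[of "Some (Node ds)" d "H_index d j m"] branch_H_tree[OF that, of m]
      unfolding ts L_def k_def by metis
    have snd: "(\<Prod>i<d. real (copies (?D i) (branch d (Node ts) (\<pi> i)))) =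
        (\<Prod>i<d. L (H_index d (\<pi> i) m) ^ b i * scaled_copies d (?D i) (H_index d (\<pi> i) m))"
      if "\<pi> \<in> ?P" for \<pi>
    proof (intro prod.cong refl)
      fix i assume "i \<in> {..<d}"
      then have "\<pi> i < d" using that permutes_in_image[of \<pi> "{..<d}" i] by simp
      then show "real (copies (?D i) (branch d (Node ts) (\<pi> i))) =
          L (H_index d (\<pi> i) m) ^ b i * scaled_copies d (?D i) (H_index d (\<pi> i) m)"
        using copies_H_tree_eq[of "?D i" d "H_index d (\<pi> i) m"] branch_H_tree[of "\<pi> i" d m]
        unfolding ts L_def b_def by metis
    qed
    have "(\<Prod>i<d. R (\<pi> i) m ^ b i * scaled_copies d (?D i) (H_index d (\<pi> i) m)) =
        (\<Prod>i<d. L (H_index d (\<pi> i) m) ^ b i * scaled_copies d (?D i) (H_index d (\<pi> i) m)) / L (Suc m) ^ k" for \<pi>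
    proof -
      have "(\<Prod>i<d. R (\<pi> i) m ^ b i * scaled_copies d (?D i) (H_index d (\<pi> i) m)) =
        (\<Prod>i<d. L (H_index d (\<pi> i) m) ^ b i * scaled_copies d (?D i) (H_index d (\<pi> i) m) / L (Suc m) ^ b i)"
        by (simp add: R_def power_divide)
      also have "\<dots> = (\<Prod>i<d. L (H_index d (\<pi> i) m) ^ b i * scaled_copies d (?D i) (H_index d (\<pi> i) m))
          / (\<Prod>i<d. L (Suc m) ^ b i)"
        by (rule prod_dividef)
      also have "(\<Prod>i<d. L (Suc m) ^ b i) = L (Suc m) ^ k"
        unfolding bsum[symmetric] by (rule power_sum[symmetric])
      finally show ?thesis .
    qed
    then have second: "second m = ?M / fact d * (\<Sum>\<pi>\<in>?P. \<Prod>i<d. L (H_index d (\<pi> i) m) ^ b i *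
        scaled_copies d (?D i) (H_index d (\<pi> i) m)) / L (Suc m) ^ k"
      by (simp only: second_def sum_divide_distrib[symmetric] times_divide_eq_right)
    have "?s (Suc m) = real (copies (Some (Node ds)) (Some (Node ts))) / L (Suc m) ^ k"
      by (simp only: scaled_copies_def ts L_def k_def)
    also have "real (copies (Some (Node ds)) (Some (Node ts))) =
        (\<Sum>j<d. L (H_index d j m) ^ k * ?s (H_index d j m)) +
        ?M / fact d * (\<Sum>\<pi>\<in>?P. \<Prod>i<d. L (H_index d (\<pi> i) m) ^ b i *
          scaled_copies d (?D i) (H_index d (\<pi> i) m))"
      unfolding copies_recurrence[OF ts' ds] using first snd
      by (intro arg_cong2[of _ _ _ _ "(+)"] arg_cong2[of _ _ _ _ "(*)"] sum.cong refl) auto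
    also have "\<dots> / L (Suc m) ^ k = (\<Sum>j<d. R j m ^ k * ?s (H_index d j m)) + second m"
      unfolding second by (simp add: add_divide_distrib sum_divide_distrib R_def power_divide)
    finally show ?thesis .
  qed
  have second: "second \<longlonglongrightarrow> ?M * (\<Prod>i<d. \<alpha> i) / real d ^ k"
  proof -
    have "second \<longlonglongrightarrow> ?M / fact d * (\<Sum>\<pi>\<in>?P. \<Prod>i<d. (1 / real d) ^ b i * \<alpha> i)"
      unfolding second_def
    proof (intro tendsto_mult_left tendsto_sum tendsto_prod tendsto_mult tendsto_power R)
      fix \<pi> i assume "i \<in> {..<d}"
      then show "(\<lambda>m. scaled_copies d (?D i) (H_index d (\<pi> i) m)) \<longlonglongrightarrow> \<alpha> i"
        using filterlim_compose[OF lim H_index_tendsto[OF d0]] by simp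
    qed
    \<comment> \<open>In the limit all branches of the \<open>H\<close> tree have the same share, so
      all \<open>d!\<close> permutations contribute equally.\<close>
    also have "(\<Sum>\<pi>\<in>?P. \<Prod>i<d. (1 / real d) ^ b i * \<alpha> i) = fact d * ((1 / real d) ^ k * (\<Prod>i<d. \<alpha> i))"
      by (simp add: prod.distrib card_permutations[of "{..<d}" d] power_sum[symmetric] bsum del: power_one_over)
    finally show ?thesis by (simp add: power_one_over field_simps)
  qed
  have sumR: "(\<lambda>m. \<Sum>j<d. R j m ^ k) \<longlonglongrightarrow> (\<Sum>j<d. (1 / real d) ^ k)"
    by (intro tendsto_sum tendsto_power R)
  have "(\<lambda>n. ?s n - a) \<longlonglongrightarrow> 0"
  \<comment> \<open>The error \<open>\<delta>\<close> is the defect of the constant sequence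
    \<open>a\<close> in the recurrence. It tends to 0 because \<open>a\<close> was defined as the
    fixed point: \<open>a * (d ^ k - d)\<close> is \<open>?M\<close> times the product of the
    \<open>\<alpha> i\<close>.\<close>
  proof (rule contraction_tendsto_zero[where J = "{..<d}" and w = "\<lambda>j m. R j m ^ k"
        and h = "H_index d" and \<delta> = "\<lambda>m. \<bar>a * (\<Sum>j<d. R j m ^ k) + second m - a\<bar>"])
    show "\<bar>?s n - a\<bar> \<le> 1 + \<bar>a\<bar>" for n
      using scaled_copies_bounds[OF d, of "Some (Node ds)" n] by linarith
    show "\<bar>?s (Suc m) - a\<bar> \<le> (\<Sum>j<d. R j m ^ k * \<bar>?s (H_index d j m) - a\<bar>) +
        \<bar>a * (\<Sum>j<d. R j m ^ k) + second m - a\<bar>" for m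
    proof -
      have "?s (Suc m) - a = (\<Sum>j<d. R j m ^ k * (?s (H_index d j m) - a)) +
          (a * (\<Sum>j<d. R j m ^ k) + second m - a)"
        unfolding rec by (simp add: right_diff_distrib sum_subtractf sum_distrib_left mult.commute)
      moreover have "\<bar>\<Sum>j<d. R j m ^ k * (?s (H_index d j m) - a)\<bar>
          \<le> (\<Sum>j<d. R j m ^ k * \<bar>?s (H_index d j m) - a\<bar>)"
        using sum_abs[of "\<lambda>j. R j m ^ k * (?s (H_index d j m) - a)" "{..<d}"] R0
        by (simp add: abs_mult)
      ultimately show ?thesis by linarith
    qed
    show "(\<lambda>m. \<Sum>j<d. R j m ^ k) \<longlonglongrightarrow> (\<Sum>j<d. (1 / real d) ^ k)" by (rule sumR)
    have dk: "real d < real d ^ k" using power_minus_base_pos[OF d k2] by simp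
    then show "(\<Sum>j<d. (1 / real d) ^ k) < 1"
      using d by (simp add: power_one_over divide_less_eq)
    have "(\<lambda>m. a * (\<Sum>j<d. R j m ^ k) + second m - a) \<longlonglongrightarrow>
        a * (\<Sum>j<d. (1 / real d) ^ k) + ?M * (\<Prod>i<d. \<alpha> i) / real d ^ k - a"
      by (intro tendsto_intros sumR second)
    also have "a * (\<Sum>j<d. (1 / real d) ^ k) + ?M * (\<Prod>i<d. \<alpha> i) / real d ^ k - a = 0"
    proof -
      have "a * (real d ^ k - real d) = ?M * (\<Prod>i<d. \<alpha> i)" using dk by (simp add: a_def)
      then show ?thesis using d by (simp add: power_one_over field_simps)
    qed
    finally show "(\<lambda>m. \<bar>a * (\<Sum>j<d. R j m ^ k) + second m - a\<bar>) \<longlonglongrightarrow> 0"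
      by (rule tendsto_rabs_zero)
  qed (use R0 H_index_tendsto[OF d0] in auto)
  then show ?thesis unfolding a_def by (rule LIM_zero_cancel)
qed

text \<open>This provides the limits \<open>\<alpha> i\<close> for the branches of \<open>D\<close>
  and ensures that the \<open>lim\<close> in \<open>eta\<close> is a genuine limit.\<close>

lemma scaled_copies_convergent:
  assumes "2 \<le> d" "dary d D"
  shows "convergent (scaled_copies d D)"
proof (cases D)
  case None
  have "scaled_copies d D = (\<lambda>_. 1)" using None by (simp add: scaled_copies_def fun_eq_iff)
  then show ?thesis by (simp add: convergent_const)
next
  case (Some t)
  have "dary_nonempty d t" using assms Some by simp
  then have "convergent (scaled_copies d (Some t))"
  proof (induction t rule: dary_nonempty_induct)
    case leaf
    have "scaled_copies d (Some (Node [])) n = 1" for n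
      unfolding scaled_copies_def copies_leaf num_leaves_H_tree[OF assms(1)]
      using real_affine_pos[of "d - 1" n] by (simp del: of_nat_add of_nat_mult of_nat_Suc)
    then have "scaled_copies d (Some (Node [])) = (\<lambda>_. 1)" by blast
    then show ?case by (simp add: convergent_const)
  next
    case (Node ds)
    have "convergent (scaled_copies d (branch d (Node ds) i))" if "i < d" for i
    proof (cases "i < length ds")
      case True
      then show ?thesis using Node that by (simp add: branch_Node)
    next
      case False
      then have "scaled_copies d (branch d (Node ds) i) = (\<lambda>_. 1)"
        using Node that by (simp add: scaled_copies_def fun_eq_iff branch_Node)
      then show ?thesis by (simp add: convergent_const)
    qed
    then have "scaled_copies d (branch d (Node ds) i) \<longlonglongrightarrow> lim (scaled_copies d (branch d (Node ds) i))"
      if "i < d" for i using that by (simp add: convergent_LIMSEQ_iff)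
    then show ?case by (rule convergentI[OF scaled_copies_tendsto[OF assms(1) Node.hyps(1,2)]])
  qed
  then show ?thesis by (simp add: Some)
qed

lemma density_H_tree_tendsto:
  assumes d: "2 \<le> d" and "scaled_copies d D \<longlonglongrightarrow> a"
  shows "(\<lambda>n. density D (Some (H_tree d n))) \<longlonglongrightarrow> a * fact (num_leaves D)"
proof -
  let ?k = "num_leaves D" and ?N = "\<lambda>n. (d - 1) * n + 1"
  have "strict_mono ?N" using d by (auto simp: strict_mono_def)
  from LIMSEQ_subseq_LIMSEQ[OF power_over_choose_tendsto this, of ?k]
  have "(\<lambda>n. scaled_copies d D n * (real (?N n) ^ ?k / real (?N n choose ?k))) \<longlonglongrightarrow> a * fact ?k"
    by (intro tendsto_mult assms(2)) (simp add: comp_def)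
  moreover have "scaled_copies d D n * (real (?N n) ^ ?k / real (?N n choose ?k)) =
      density D (Some (H_tree d n))" for n
    unfolding density_def num_leaves_H_tree[OF d] copies_H_tree_eq by simp
  ultimately show ?thesis by simp
qed

section \<open>Comparison of \<open>eta\<close> with the inducibility\<close>

lemma eta_eq:
  "2 \<le> d \<Longrightarrow> scaled_copies d D \<longlonglongrightarrow> a \<Longrightarrow> eta d D = a * fact (num_leaves D)"
  unfolding eta_def by (rule limI) (rule density_H_tree_tendsto)

lemma eta_le_inducibility:
  assumes d: "2 \<le> d" and "scaled_copies d D \<longlonglongrightarrow> a"
  shows "eta d D \<le> inducibility d D"
proof (rule inducibility_ge[OF d, where T = "\<lambda>n. Some (H_tree d n)"])
  show "strict_mono (\<lambda>n. num_leaves (Some (H_tree d n)))"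
    using d by (auto simp: strict_mono_def num_leaves_H_tree)
  show "(\<lambda>n. density D (Some (H_tree d n))) \<longlonglongrightarrow> eta d D"
    unfolding eta_eq[OF assms] by (rule density_H_tree_tendsto[OF assms])
qed (use d in \<open>simp_all add: dary_H_tree\<close>)

theorem theorem8:
  fixes d :: nat and D :: rtree
  assumes "d \<ge> 2"
    and "dary d (Some D)"
    and "num_leaves (Some D) \<ge> 2"
    and "balanced d D"
  shows "inducibility d (Some D)
           \<le> real (card (perm_reps d D)) / (real d ^ num_leaves (Some D) - real d)
              * (fact (num_leaves (Some D)) / (\<Prod>i<d. fact (num_leaves (branch d D i))))
              * (\<Prod>i<d. inducibility d (branch d D i))
         \<and> ((\<forall>i<d. inducibility d (branch d D i) = eta d (branch d D i))
              \<longrightarrow> inducibility d (Some D) = eta d (Some D))"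
proof -
  obtain ds where D: "D = Node ds" by (cases D)
  have dary: "dary_nonempty d (Node ds)" using assms(2) D by simp
  moreover have "ds \<noteq> []" using assms(3) D by auto
  ultimately have ds: "2 \<le> length ds" "length ds \<le> d" by auto
  let ?k = "num_leaves (Some D)" and ?b = "\<lambda>i. num_leaves (branch d D i)" and ?M = "real (card (perm_reps d D))"
  have bound: "inducibility d (Some D) \<le>
      fact ?k * (?M * (\<Prod>i<d. inducibility d (branch d D i) / fact (?b i)) / (real d ^ ?k - real d))"
    using balanced_inducibility_bound[OF assms(1) dary ds] assms(4) D by simp
  also have "\<dots> = ?M / (real d ^ ?k - real d) * (fact ?k / (\<Prod>i<d. fact (?b i)))
      * (\<Prod>i<d. inducibility d (branch d D i))"
    by (simp add: prod_dividef mult_ac)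
  finally have "inducibility d (Some D) \<le> \<dots>" .
  moreover have "inducibility d (Some D) = eta d (Some D)"
    if eq: "\<forall>i<d. inducibility d (branch d D i) = eta d (branch d D i)"
  proof -
    define \<alpha> where "\<alpha> i = lim (scaled_copies d (branch d D i))" for i
    have \<alpha>: "scaled_copies d (branch d D i) \<longlonglongrightarrow> \<alpha> i" if "i < d" for i
      using scaled_copies_convergent[OF assms(1) dary_branch[OF dary that]] D
      unfolding \<alpha>_def by (simp add: convergent_LIMSEQ_iff)
    have lim: "scaled_copies d (Some D) \<longlonglongrightarrow> ?M * (\<Prod>i<d. \<alpha> i) / (real d ^ ?k - real d)"
      unfolding D by (rule scaled_copies_tendsto[OF assms(1) ds]) (use \<alpha> D in blast)
    \<comment> \<open>Since \<open>eta\<close> of a branch is \<open>\<alpha> i\<close> times the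
      factorial of its leaf number, the hypothesis turns the upper bound into the limit along the
      \<open>H\<close> trees. The opposite inequality holds because these trees form a test sequence
      for the inducibility.\<close>
    have "inducibility d (branch d D i) / fact (?b i) = \<alpha> i" if "i < d" for i
      using eq eta_eq[OF assms(1) \<alpha>[OF that]] that by simp
    then have "(\<Prod>i<d. inducibility d (branch d D i) / fact (?b i)) = (\<Prod>i<d. \<alpha> i)"
      by (intro prod.cong) auto
    then have "inducibility d (Some D) \<le> eta d (Some D)"
      using bound eta_eq[OF assms(1) lim] by (simp add: mult.commute)
    then show ?thesis using eta_le_inducibility[OF assms(1) lim] by simp
  qed
  ultimately show ?thesis by blast
qed

end
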